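(* Let $D$ be a selfadjoint operator in a Hilbert space $H$ with orthonormal eigenvectors $e_n$, $n\in\mathbb{N}=\{1,2,\dots\}$, forming a basis of $H$, and corresponding eigenvalues $\mu_n$, where $\mu_1<\mu_2<\dots<\mu_n<\dots$ and $\lim_{n\to\infty}\mu_n=+\infty$. Let $R$ be either a symmetric operator that is relatively compact with respect to $D$, or an arbitrary compact operator. Denote $$\Delta_n^2=\sum_{m=1}^{\infty}\frac{\|Re_m\|^2}{\|(D-\mu_nE-r_nE_n)e_m\|^2},\qquad r_n=\tfrac12\min\{\mu_n-\mu_{n-1},\ \mu_{n+1}-\mu_n\},$$ where $E$ is the identity operator and the operator $E_n$ is defined by $E_ne_m=e_m$ for $m>n$ and $E_ne_m=-e_m$ for $m\le n$. Suppose that the $\Delta_n$ exist and $\Delta_n\to0$ as $n\to\infty$. Then for the eigenvalues $\lambda_n$ of the operator $T=D+R$ (which also has discrete spectrum) the following asymptotic formula holds: $$\lambda_n=\mu_n+(Re_n,e_n)+O\left(\Delta_n\|R^*e_n\|\right),\qquad n\to\infty.$$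
   Context: The inner product $(\cdot,\cdot)$ is linear in its first argument, and $\Delta_n\ge0$. An operator $R$ is relatively compact with respect to $D$ if $\mathscr{D}(D)\subseteq\mathscr{D}(R)$ and $R(D-zE)^{-1}$ is compact for some (equivalently every) $z$ in the resolvent set of $D$. $T=D+R$ has domain $\mathscr{D}(D)$. The quantities $r_n$, $\Delta_n$ are considered for $n\ge2$ (only large $n$ matters). For all sufficiently large $n$, $\lambda_n$ denotes the eigenvalue of $T$ lying inside the circle $\{\lambda\in\mathbb{C}:|\lambda-\mu_n|=r_n\}$ (there is exactly one such eigenvalue for all sufficiently large $n$); no global ordering of the eigenvalues of $T$ is asserted. *)

theory Defs
  imports "HOL-Analysis.Analysis" "HOL-Library.Landau_Symbols"
begin

section \<open>Complex Hilbert spaces\<close>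

text \<open>The norm, topology and completeness are those of the underlying real Hilbert space;
  \<open>Re_cinner\<close> makes the real inner product the real part of the complex one, so that
  \<open>norm x ^ 2 = cinner x x\<close>. The complex inner product is linear in its first argument.\<close>

class complex_hilbert_space = real_inner + complete_space +
  fixes scaleC :: "complex \<Rightarrow> 'a \<Rightarrow> 'a" (infixr \<open>*\<^sub>C\<close> 75)
    and cinner :: "'a \<Rightarrow> 'a \<Rightarrow> complex"
  assumes scaleC_add_right: "a *\<^sub>C (x + y) = a *\<^sub>C x + a *\<^sub>C y"
    and scaleC_add_left: "(a + b) *\<^sub>C x = a *\<^sub>C x + b *\<^sub>C x"
    and scaleC_scaleC: "a *\<^sub>C (b *\<^sub>C x) = (a * b) *\<^sub>C x"
    and scaleC_of_real: "complex_of_real r *\<^sub>C x = r *\<^sub>R x"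
    and cinner_commute: "cinner x y = cnj (cinner y x)"
    and cinner_add_left: "cinner (x + y) z = cinner x z + cinner y z"
    and cinner_scaleC_left: "cinner (a *\<^sub>C x) y = a * cinner x y"
    and Re_cinner: "Re (cinner x y) = x \<bullet> y"

global_interpretation complex_vector: vector_space "scaleC :: complex \<Rightarrow> 'a \<Rightarrow> 'a::complex_hilbert_space"
  defines cspan = complex_vector.span
    and csubspace = complex_vector.subspace
proof
  fix x :: 'a
  show "1 *\<^sub>C x = x"
    using scaleC_of_real[of 1 x] by simp
qed (simp_all add: scaleC_add_right scaleC_add_left scaleC_scaleC)

definition orthonormal_basis :: "(nat \<Rightarrow> 'a::complex_hilbert_space) \<Rightarrow> nat set \<Rightarrow> bool" where
  "orthonormal_basis e I \<longleftrightarrow>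
     (\<forall>m\<in>I. \<forall>n\<in>I. cinner (e m) (e n) = (if m = n then 1 else 0)) \<and>
     closure (cspan (e ` I)) = UNIV"

section \<open>Unbounded operators\<close>

text \<open>An operator is given by its domain \<open>S\<close> and a function \<open>A\<close> whose values off \<open>S\<close> are
  irrelevant.\<close>

definition linear_op :: "'a::complex_hilbert_space set \<Rightarrow> ('a \<Rightarrow> 'a) \<Rightarrow> bool" where
  "linear_op S A \<longleftrightarrow> csubspace S \<and>
     (\<forall>x\<in>S. \<forall>y\<in>S. A (x + y) = A x + A y) \<and> (\<forall>c. \<forall>x\<in>S. A (c *\<^sub>C x) = c *\<^sub>C A x)"

definition adjoint_dom :: "'a::complex_hilbert_space set \<Rightarrow> ('a \<Rightarrow> 'a) \<Rightarrow> 'a set" where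
  "adjoint_dom S A = {y. \<exists>z. \<forall>x\<in>S. cinner (A x) y = cinner x z}"

text \<open>Meaningful for dense \<open>S\<close> and \<open>y \<in> adjoint_dom S A\<close>, where the element is unique.\<close>

definition adjoint_op :: "'a::complex_hilbert_space set \<Rightarrow> ('a \<Rightarrow> 'a) \<Rightarrow> 'a \<Rightarrow> 'a" where
  "adjoint_op S A y = (THE z. \<forall>x\<in>S. cinner (A x) y = cinner x z)"

definition symmetric_op :: "'a::complex_hilbert_space set \<Rightarrow> ('a \<Rightarrow> 'a) \<Rightarrow> bool" where
  "symmetric_op S A \<longleftrightarrow> linear_op S A \<and> closure S = UNIV \<and>
     (\<forall>x\<in>S. \<forall>y\<in>S. cinner (A x) y = cinner x (A y))"

definition selfadjoint_op :: "'a::complex_hilbert_space set \<Rightarrow> ('a \<Rightarrow> 'a) \<Rightarrow> bool" where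
  "selfadjoint_op S A \<longleftrightarrow> linear_op S A \<and> closure S = UNIV \<and>
     adjoint_dom S A = S \<and> (\<forall>y\<in>S. adjoint_op S A y = A y)"

definition resolvent :: "'a::complex_hilbert_space set \<Rightarrow> ('a \<Rightarrow> 'a) \<Rightarrow> complex \<Rightarrow> 'a \<Rightarrow> 'a" where
  "resolvent S A z = the_inv_into S (\<lambda>x. A x - z *\<^sub>C x)"

definition resolvent_set :: "'a::complex_hilbert_space set \<Rightarrow> ('a \<Rightarrow> 'a) \<Rightarrow> complex set" where
  "resolvent_set S A = {z. bij_betw (\<lambda>x. A x - z *\<^sub>C x) S UNIV \<and>
     bounded_linear (resolvent S A z)}"

definition op_spectrum :: "'a::complex_hilbert_space set \<Rightarrow> ('a \<Rightarrow> 'a) \<Rightarrow> complex set" where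
  "op_spectrum S A = - resolvent_set S A"

definition eigenvalue_op :: "'a::complex_hilbert_space set \<Rightarrow> ('a \<Rightarrow> 'a) \<Rightarrow> complex \<Rightarrow> bool" where
  "eigenvalue_op S A z \<longleftrightarrow> (\<exists>x\<in>S. x \<noteq> 0 \<and> A x = z *\<^sub>C x)"

text \<open>\<open>ker_power S A z k\<close> is the kernel of the \<open>k\<close>-th power of \<open>A - z E\<close> on its natural domain.
  The union of these kernels is the root subspace, whose dimension is the algebraic multiplicity
  of \<open>z\<close>.\<close>

primrec ker_power :: "'a::complex_hilbert_space set \<Rightarrow> ('a \<Rightarrow> 'a) \<Rightarrow> complex \<Rightarrow> nat \<Rightarrow> 'a set" where
  "ker_power S A z 0 = {0}"
| "ker_power S A z (Suc k) = {x \<in> S. A x - z *\<^sub>C x \<in> ker_power S A z k}"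

definition discrete_spectrum :: "'a::complex_hilbert_space set \<Rightarrow> ('a \<Rightarrow> 'a) \<Rightarrow> bool" where
  "discrete_spectrum S A \<longleftrightarrow> (\<forall>z. \<not> z islimpt op_spectrum S A) \<and>
     (\<forall>z\<in>op_spectrum S A. eigenvalue_op S A z \<and>
        (\<exists>B. finite B \<and> (\<Union>k. ker_power S A z k) \<subseteq> cspan B))"

definition compact_op :: "('a::complex_hilbert_space \<Rightarrow> 'a) \<Rightarrow> bool" where
  "compact_op K \<longleftrightarrow> linear_op UNIV K \<and> (\<forall>B. bounded B \<longrightarrow> compact (closure (K ` B)))"

definition relatively_compact_op ::
  "'a::complex_hilbert_space set \<Rightarrow> ('a \<Rightarrow> 'a) \<Rightarrow> 'a set \<Rightarrow> ('a \<Rightarrow> 'a) \<Rightarrow> bool" where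
  "relatively_compact_op S D S' R \<longleftrightarrow> S \<subseteq> S' \<and>
     (\<exists>z\<in>resolvent_set S D. compact_op (\<lambda>x. R (resolvent S D z x)))"

section \<open>The quantities \<open>r\<^sub>n\<close>, \<open>E\<^sub>n\<close> and \<open>\<Delta>\<^sub>n\<close>\<close>

definition half_gap :: "(nat \<Rightarrow> real) \<Rightarrow> nat \<Rightarrow> real" where
  "half_gap \<mu> n = min (\<mu> n - \<mu> (n - 1)) (\<mu> (n + 1) - \<mu> n) / 2"

text \<open>\<open>E\<^sub>n\<close> is determined by its values on the basis, given in \<open>sign_op_basis\<close>.\<close>

definition sign_op :: "(nat \<Rightarrow> 'a::complex_hilbert_space) \<Rightarrow> nat \<Rightarrow> 'a \<Rightarrow> 'a" where
  "sign_op e n x = x - 2 *\<^sub>C (\<Sum>m=1..n. cinner x (e m) *\<^sub>C e m)"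

lemma sign_op_basis:
  assumes "orthonormal_basis e {1..}" "m \<ge> 1"
  shows "sign_op e n (e m) = (if m > n then e m else - e m)"
proof -
  have "cinner (e m) (e k) *\<^sub>C e k = (if k = m then e m else 0)" if "k \<in> {1..n}" for k
    using assms that unfolding orthonormal_basis_def by auto
  then have "(\<Sum>k=1..n. cinner (e m) (e k) *\<^sub>C e k) = (\<Sum>k=1..n. if k = m then e m else 0)"
    by (rule sum.cong[OF refl])
  also have "\<dots> = (if m \<le> n then e m else 0)"
    using assms(2) by simp
  moreover have "2 *\<^sub>C e m = e m + e m"
    using complex_vector.scale_left_distrib[of 1 1 "e m"] by simp
  ultimately show ?thesis
    by (auto simp: sign_op_def)
qed

definition Delta_term ::
  "('a::complex_hilbert_space \<Rightarrow> 'a) \<Rightarrow> ('a \<Rightarrow> 'a) \<Rightarrow> (nat \<Rightarrow> real) \<Rightarrow> (nat \<Rightarrow> 'a) \<Rightarrow> nat \<Rightarrow> nat \<Rightarrow> real"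
where
  "Delta_term D R \<mu> e n m =
     (norm (R (e m)))\<^sup>2 /
     (norm (D (e m) - of_real (\<mu> n) *\<^sub>C e m - of_real (half_gap \<mu> n) *\<^sub>C sign_op e n (e m)))\<^sup>2"

definition Delta ::
  "('a::complex_hilbert_space \<Rightarrow> 'a) \<Rightarrow> ('a \<Rightarrow> 'a) \<Rightarrow> (nat \<Rightarrow> real) \<Rightarrow> (nat \<Rightarrow> 'a) \<Rightarrow> nat \<Rightarrow> real"
where
  "Delta D R \<mu> e n = sqrt (\<Sum>\<^sub>\<infinity>m\<in>{1..}. Delta_term D R \<mu> e n m)"

end

theory Submission
  imports Defs "HOL-Library.Diagonal_Subsequence"
begin

text \<open>
  Write \<open>S\<^sub>\<lambda>\<close> for the reduced resolvent of \<open>D\<close> at \<open>\<mu>\<^sub>n\<close>, that is \<open>(D - \<lambda>)\<close> inverted on the complement of \<open>e\<^sub>n\<close>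
  and \<open>0\<close> at \<open>e\<^sub>n\<close>. For \<open>\<lambda>\<close> in the disc of radius \<open>r\<^sub>n\<close> about \<open>\<mu>\<^sub>n\<close> the number \<open>\<Delta>\<^sub>n\<close> bounds the Hilbert--Schmidt
  norm of \<open>R S\<^sub>\<lambda>\<close>, and also bounds \<open>\<parallel>R e\<^sub>n\<parallel> / r\<^sub>n\<close>. A vector \<open>x\<close> with \<open>n\<close>-th coefficient 1 is an eigenvector of
  \<open>D + R\<close> for \<open>\<lambda>\<close> iff \<open>h = R x / r\<^sub>n\<close> satisfies \<open>x = e\<^sub>n - r\<^sub>n S\<^sub>\<lambda> h\<close> and \<open>\<lambda> = \<mu>\<^sub>n + r\<^sub>n (h, e\<^sub>n)\<close>. This is a fixed point
  equation for \<open>h\<close> alone, and for small \<open>\<Delta>\<^sub>n\<close> it is a contraction of the unit ball, which gives existence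
  and uniqueness of \<open>\<lambda>\<^sub>n\<close>. The fixed point has norm \<open>O(\<Delta>\<^sub>n)\<close>, so the error term
  \<open>r\<^sub>n (R S\<^sub>\<lambda> h, e\<^sub>n) = r\<^sub>n (S\<^sub>\<lambda> h, R\<^sup>* e\<^sub>n)\<close> is \<open>O(\<Delta>\<^sub>n \<parallel>R\<^sup>* e\<^sub>n\<parallel>)\<close>.

  At \<open>\<mu>\<^sub>n + r\<^sub>n\<close> the norm of \<open>R (D - \<lambda>)\<^sup>-\<^sup>1\<close> is less than 1, so \<open>D + R\<close> has a compact resolvent there, and
  Riesz theory of compact operators gives the discreteness of the spectrum.
\<close>

instance complex_hilbert_space \<subseteq> banach ..

section \<open>The complex inner product\<close>

lemma cinner_add_right: "cinner x (y + z) = cinner x y + cinner x z"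
  by (metis cinner_add_left cinner_commute complex_cnj_add)

lemma cinner_scaleC_right: "cinner x (a *\<^sub>C y) = cnj a * cinner x y"
  by (metis cinner_commute cinner_scaleC_left complex_cnj_mult)

lemma cinner_self: "cinner x x = complex_of_real ((norm x)\<^sup>2)"
proof (rule complex_eqI)
  show "Im (cinner x x) = Im (complex_of_real ((norm x)\<^sup>2))"
    using arg_cong[OF cinner_commute[of x x], of Im] by simp
qed (simp add: Re_cinner power2_norm_eq_inner)

lemma norm_scaleC [simp]: "norm (a *\<^sub>C x) = cmod a * norm x"
proof -
  have "complex_of_real ((norm (a *\<^sub>C x))\<^sup>2) = (a * cnj a) * cinner x x"
    by (simp only: cinner_self[symmetric] cinner_scaleC_left cinner_scaleC_right mult_ac)
  also have "\<dots> = complex_of_real ((cmod a * norm x)\<^sup>2)"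
    by (simp only: cinner_self complex_norm_square[symmetric] power_mult_distrib of_real_mult of_real_power)
  finally have "(norm (a *\<^sub>C x))\<^sup>2 = (cmod a * norm x)\<^sup>2"
    by (simp only: of_real_eq_iff)
  then show ?thesis
    by (simp add: power2_eq_iff_nonneg)
qed

text \<open>The Cauchy-Schwarz inequality of the real structure bounds only the real part.
  Multiplying \<open>x\<close> by the unimodular number \<open>c\<close> makes the complex inner
  product real and nonnegative, so the real inequality applies.\<close>

lemma norm_cinner_le: "cmod (cinner x y) \<le> norm x * norm y"
proof (cases "cinner x y = 0")
  case False
  define c where "c = cnj (sgn (cinner x y))"
  have c: "cmod c = 1" using False by (simp add: c_def norm_sgn)
  have "cnj (sgn z) * z = complex_of_real (cmod z)" if "z \<noteq> 0" for z
    using that complex_norm_square[of z]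
    by (simp add: sgn_div_norm scaleR_conv_of_real field_simps power2_eq_square)
  then have "cmod (cinner x y) = Re (cinner (c *\<^sub>C x) y)"
    using False by (simp add: cinner_scaleC_left c_def)
  also have "\<dots> \<le> norm (c *\<^sub>C x) * norm y"
    unfolding Re_cinner by (rule norm_cauchy_schwarz)
  finally show ?thesis by (simp add: c)
qed simp

text \<open>Over the reals, conjugate-linearity in the second argument is plain linearity, so limits
  and series can be moved through both arguments.\<close>

lemma bounded_bilinear_cinner: "bounded_bilinear cinner"
proof
  show "\<exists>K. \<forall>a b. cmod (cinner (a::'a) b) \<le> norm a * norm b * K"
    by (rule exI[of _ 1]) (simp add: norm_cinner_le)
qed (simp_all add: cinner_add_left cinner_add_right scaleC_of_real[symmetric] cinner_scaleC_left
      cinner_scaleC_right scaleR_conv_of_real)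

interpretation cinner: bounded_bilinear cinner
  by (rule bounded_bilinear_cinner)

lemma bounded_bilinear_scaleC: "bounded_bilinear scaleC"
proof
  show "\<exists>K. \<forall>a b. norm (a *\<^sub>C (b::'a)) \<le> norm a * norm b * K"
    by (rule exI[of _ 1]) simp
  show "(r *\<^sub>R a) *\<^sub>C b = r *\<^sub>R a *\<^sub>C b" "a *\<^sub>C r *\<^sub>R b = r *\<^sub>R a *\<^sub>C b" for r a and b :: 'a
    by (simp_all add: scaleC_of_real[symmetric] scaleR_conv_of_real mult.commute)
qed (simp_all add: scaleC_add_left scaleC_add_right)

interpretation scaleC: bounded_bilinear scaleC
  by (rule bounded_bilinear_scaleC)

lemma cinner_eq_zero_commute: "cinner x y = 0 \<longleftrightarrow> cinner y x = 0"
  by (metis cinner_commute complex_cnj_zero_iff)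

lemma cinner_span_eq_zero:
  assumes "\<And>y. y \<in> F \<Longrightarrow> cinner x y = 0" "z \<in> cspan F"
  shows "cinner x z = 0"
  using assms(2)
  by (induction rule: complex_vector.span_induct_alt)
     (simp_all add: assms(1) cinner_add_right cinner_scaleC_right cinner.zero_right)

text \<open>A sequence in \<open>S\<close> tending to \<open>y - z\<close> has vanishing inner
  products with \<open>y - z\<close>, so in the limit
  \<open>cinner (y - z) (y - z) = 0\<close>.\<close>

lemma cinner_dense_eqI:
  assumes "closure S = UNIV" "\<And>x. x \<in> S \<Longrightarrow> cinner x y = cinner x z"
  shows "y = z"
proof -
  have "y - z \<in> closure S" using assms(1) by simp
  then obtain u where u: "\<And>n. u n \<in> S" "u \<longlonglongrightarrow> y - z"
    by (auto simp: closure_sequential)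
  have "(\<lambda>n. cinner (u n) (y - z)) \<longlonglongrightarrow> cinner (y - z) (y - z)"
    by (intro cinner.tendsto u tendsto_const)
  moreover have "(\<lambda>n. cinner (u n) (y - z)) = (\<lambda>n. 0)"
    using assms(2) u by (simp add: cinner.diff_right)
  ultimately have "cinner (y - z) (y - z) = 0"
    by (simp add: LIMSEQ_const_iff)
  then show ?thesis by (simp add: cinner_self)
qed

lemma adjoint_op_eqI:
  assumes "closure S = UNIV" "\<forall>x\<in>S. cinner (A x) y = cinner x z"
  shows "adjoint_op S A y = z"
  unfolding adjoint_op_def
proof (rule the_equality)
  show "w = z" if "\<forall>x\<in>S. cinner (A x) y = cinner x w" for w
    by (rule cinner_dense_eqI[OF assms(1)]) (use assms(2) that in metis)
qed (rule assms(2))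

text \<open>Gram-Schmidt: to add \<open>a\<close> to \<open>F\<close>, the projection
  \<open>p\<close> is corrected by a multiple of \<open>a'\<close>, the component of
  \<open>a\<close> orthogonal to the span of \<open>F\<close>.\<close>

lemma projection_onto_finite_span:
  assumes "finite F"
  shows "\<exists>p\<in>cspan F. \<forall>y\<in>cspan F. cinner (x - p) y = 0"
proof -
  have "\<exists>p\<in>cspan F. \<forall>y\<in>F. cinner (x - p) y = 0"
    using assms
  proof (induction F arbitrary: x)
    case empty
    then show ?case by (auto intro: complex_vector.span_zero)
  next
    case (insert a F)
    obtain q where q: "q \<in> cspan F" "\<forall>y\<in>F. cinner (a - q) y = 0" using insert.IH by blast
    obtain p where p: "p \<in> cspan F" "\<forall>y\<in>F. cinner (x - p) y = 0" using insert.IH by blast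
    define a' where "a' = a - q"
    \<comment> \<open>If \<open>a' = 0\<close>, division by zero gives \<open>t = 0\<close>; then
      \<open>a\<close> already lies in the span of \<open>F\<close> and
      \<open>p' = p\<close>.\<close>
    define t where "t = cinner (x - p) a' / cinner a' a'"
    define p' where "p' = p + t *\<^sub>C a'"
    have sub: "cspan F \<subseteq> cspan (insert a F)"
      by (rule complex_vector.span_mono) auto
    have "a' \<in> cspan (insert a F)"
      unfolding a'_def using q(1) sub
      by (intro complex_vector.span_diff) (auto intro: complex_vector.span_base)
    then have "p' \<in> cspan (insert a F)"
      unfolding p'_def using p(1) sub
      by (intro complex_vector.span_add complex_vector.span_scale) auto
    moreover have F: "\<forall>y\<in>F. cinner (x - p') y = 0"
      using p q by (simp add: p'_def a'_def cinner.diff_left cinner_add_left cinner_scaleC_left)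
    moreover have "cinner (x - p') a = 0"
    proof -
      have "cinner (x - p') q = 0" using F q(1) cinner_span_eq_zero by blast
      moreover have "cinner (x - p') a' = 0"
        by (cases "a' = 0")
           (simp_all add: p'_def t_def cinner.diff_left cinner_add_left cinner_scaleC_left cinner_self cinner.zero_right)
      moreover have "a = q + a'" by (simp add: a'_def)
      ultimately show ?thesis by (simp add: cinner_add_right)
    qed
    ultimately show ?case by auto
  qed
  then show ?thesis using cinner_span_eq_zero by blast
qed

section \<open>Compact operators\<close>

lemma linear_opD:
  assumes "linear_op S A"
  shows "csubspace S" "x \<in> S \<Longrightarrow> y \<in> S \<Longrightarrow> A (x + y) = A x + A y"
    "x \<in> S \<Longrightarrow> A (c *\<^sub>C x) = c *\<^sub>C A x"
  using assms by (auto simp: linear_op_def)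

lemma linear_op_diff:
  assumes "linear_op S A" "x \<in> S" "y \<in> S"
  shows "A (x - y) = A x - A y"
proof -
  have "A (x + (-1) *\<^sub>C y) = A x + (-1) *\<^sub>C A y"
    using assms linear_opD[OF assms(1)] complex_vector.subspace_scale by metis
  then show ?thesis by simp
qed

lemma linear_op_zero: "linear_op S A \<Longrightarrow> A 0 = 0"
  using linear_op_diff[of S A 0 0] linear_opD(1)[of S A] complex_vector.subspace_0[of S] by auto

lemma linear_op_sum:
  assumes "linear_op S A" "\<And>i. i \<in> I \<Longrightarrow> f i \<in> S"
  shows "A (\<Sum>i\<in>I. f i) = (\<Sum>i\<in>I. A (f i))"
  using assms(2)
proof (induction I rule: infinite_finite_induct)
  case (insert i I)
  then show ?case
    using linear_opD[OF assms(1)] by (simp add: complex_vector.subspace_sum)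
qed (simp_all add: linear_op_zero[OF assms(1)])

lemma linear_op_imp_linear: "linear_op UNIV K \<Longrightarrow> linear K"
  by (rule linearI) (auto simp: linear_opD scaleC_of_real[symmetric])

lemma linear_op_span_image:
  assumes "linear_op UNIV K" "x \<in> cspan F" "\<And>y. y \<in> F \<Longrightarrow> K y \<in> M" "csubspace M"
  shows "K x \<in> M"
  using assms(2)
proof (induction rule: complex_vector.span_induct_alt)
  case base
  show ?case using assms by (simp add: linear_op_zero complex_vector.subspace_0)
next
  case (step c x y)
  then show ?case using assms
    by (simp add: linear_opD complex_vector.subspace_add complex_vector.subspace_scale)
qed

lemma compact_op_bounded_linear:
  assumes "compact_op K"
  shows "bounded_linear K"
proof -
  have lin: "linear K" using assms by (auto simp: compact_op_def linear_op_imp_linear)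
  have "bounded (K ` cball 0 1)"
    using assms compact_imp_bounded bounded_subset[OF _ closure_subset]
    by (metis bounded_cball compact_op_def)
  then obtain B where B: "\<And>x. norm x \<le> 1 \<Longrightarrow> norm (K x) \<le> B"
    unfolding bounded_iff by (metis imageI mem_cball_0)
  have "norm (K x) \<le> norm x * B" for x
  proof (cases "x = 0")
    case False
    have "norm (K ((1 / norm x) *\<^sub>R x)) \<le> B"
      using False by (intro B) simp
    then show ?thesis
      using False by (simp add: linear_cmul[OF lin] divide_simps mult.commute)
  qed (simp add: linear_0[OF lin])
  then show ?thesis
    using lin by (intro bounded_linear_intro) (auto simp: linear_add linear_cmul)
qed

lemma compact_op_convergent_subseq:
  assumes "compact_op K" "bounded (range u)"
  shows "\<exists>r l. strict_mono (r::nat \<Rightarrow> nat) \<and> (\<lambda>n. K (u (r n))) \<longlonglongrightarrow> l"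
proof -
  have "compact (closure (K ` range u))" using assms by (auto simp: compact_op_def)
  moreover have "\<forall>n. K (u n) \<in> closure (K ` range u)"
    using closure_subset by fastforce
  ultimately show ?thesis
    by (auto simp: compact_def o_def dest!: spec[of _ "\<lambda>n. K (u n)"])
qed

text \<open>The form in which compactness is contradicted below: a convergent subsequence of images
  is Cauchy, hence not separated by \<open>\<delta>\<close>.\<close>

lemma compact_op_not_separated:
  assumes "compact_op K" "bounded (range u)" "\<delta> > 0"
    and "\<And>m n::nat. m < n \<Longrightarrow> \<delta> \<le> norm (K (u n) - K (u m))"
  shows False
proof -
  obtain r l where r: "strict_mono (r::nat \<Rightarrow> nat)" and l: "(\<lambda>n. K (u (r n))) \<longlonglongrightarrow> l"
    using compact_op_convergent_subseq assms(1,2) by blast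
  have "Cauchy (\<lambda>n. K (u (r n)))" using l by (rule LIMSEQ_imp_Cauchy)
  then obtain N where "\<forall>m\<ge>N. \<forall>n\<ge>N. norm (K (u (r m)) - K (u (r n))) < \<delta>"
    using \<open>\<delta> > 0\<close> by (auto simp: Cauchy_iff)
  then have "norm (K (u (r (Suc N))) - K (u (r N))) < \<delta>" by simp
  moreover have "r N < r (Suc N)" using r by (simp add: strict_mono_def)
  ultimately show False using assms(4)[of "r N" "r (Suc N)"] by simp
qed

text \<open>Points of the closure are replaced by points of \<open>S\<close> at distance below
  \<open>1 / (n + 1)\<close>; a limit along a subsequence of the latter is also a limit of the
  former.\<close>

lemma compact_closure_sequentialI:
  fixes S :: "'b::metric_space set"
  assumes "\<And>u::nat \<Rightarrow> 'b. range u \<subseteq> S \<Longrightarrow> \<exists>r l. strict_mono (r::nat \<Rightarrow> nat) \<and> (\<lambda>n. u (r n)) \<longlonglongrightarrow> l"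
  shows "compact (closure S)"
  unfolding compact_def
proof (intro allI impI)
  fix f :: "nat \<Rightarrow> 'b"
  assume f: "\<forall>n. f n \<in> closure S"
  have "\<forall>n. \<exists>y\<in>S. dist y (f n) < inverse (real (Suc n))"
    using f by (simp add: closure_approachable)
  then obtain u where u: "\<And>n. u n \<in> S" "\<And>n. dist (u n) (f n) < inverse (real (Suc n))"
    by metis
  obtain r l where r: "strict_mono (r::nat \<Rightarrow> nat)" and l: "(\<lambda>n. u (r n)) \<longlonglongrightarrow> l"
    using assms[of u] u(1) by blast
  have 0: "(\<lambda>n. dist (u n) (f n)) \<longlonglongrightarrow> 0"
    by (rule tendsto_sandwich[OF _ _ tendsto_const LIMSEQ_inverse_real_of_nat])
       (use u(2) in \<open>auto intro!: always_eventually less_imp_le simp del: of_nat_Suc\<close>)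
  have "(\<lambda>n. dist (u (r n)) (f (r n))) \<longlonglongrightarrow> 0"
    using LIMSEQ_subseq_LIMSEQ[OF 0 r] by (simp add: o_def)
  from tendsto_add[OF this l[THEN tendsto_dist_iff[THEN iffD1]]]
  have "(\<lambda>n. dist (u (r n)) (f (r n)) + dist (u (r n)) l) \<longlonglongrightarrow> 0" by simp
  then have "(\<lambda>n. dist (f (r n)) l) \<longlonglongrightarrow> 0"
    by (rule tendsto_sandwich[OF _ _ tendsto_const, rotated 2])
       (intro always_eventually allI dist_triangle3 zero_le_dist)+
  then have "(\<lambda>n. f (r n)) \<longlonglongrightarrow> l" by (rule tendsto_dist_iff[THEN iffD2])
  moreover have "l \<in> closure S"
    using l u(1) closure_sequential by (metis (no_types, lifting))
  ultimately show "\<exists>l\<in>closure S. \<exists>r. strict_mono r \<and> (f \<circ> r) \<longlonglongrightarrow> l"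
    using r by (auto simp: o_def)
qed

lemma compact_op_scale:
  assumes "compact_op K"
  shows "compact_op (\<lambda>x. c *\<^sub>C K x)"
  unfolding compact_op_def
proof (intro conjI allI impI)
  show "linear_op UNIV (\<lambda>x. c *\<^sub>C K x)"
    using assms
    by (auto simp: compact_op_def linear_op_def scaleC_add_right scaleC_scaleC mult.commute)
  fix B :: "'a set"
  assume B: "bounded B"
  show "compact (closure ((\<lambda>x. c *\<^sub>C K x) ` B))"
  proof (rule compact_closure_sequentialI)
    fix u :: "nat \<Rightarrow> 'a"
    assume "range u \<subseteq> (\<lambda>x. c *\<^sub>C K x) ` B"
    then have "\<forall>n. \<exists>v\<in>B. u n = c *\<^sub>C K v" by blast
    then obtain v where v: "\<And>n. v n \<in> B" "\<And>n. u n = c *\<^sub>C K (v n)" by metis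
    obtain r l where r: "strict_mono (r::nat \<Rightarrow> nat)" and l: "(\<lambda>n. K (v (r n))) \<longlonglongrightarrow> l"
      using compact_op_convergent_subseq[OF assms, of v] B v(1) by (metis bounded_subset image_subsetI)
    have "(\<lambda>n. c *\<^sub>C K (v (r n))) \<longlonglongrightarrow> c *\<^sub>C l"
      by (intro scaleC.tendsto tendsto_const l)
    then show "\<exists>r l. strict_mono r \<and> (\<lambda>n. u (r n)) \<longlonglongrightarrow> l"
      using r v(2) by auto
  qed
qed

text \<open>An orthonormalisation of \<open>v\<close> makes \<open>K\<close> triangular with diagonal \<open>\<kappa>\<close>, so the images of the
  orthonormal vectors have mutual distance at least \<open>\<delta>\<close>.\<close>

lemma compact_op_no_triangular_sequence:
  fixes v :: "nat \<Rightarrow> 'a::complex_hilbert_space"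
  assumes K: "compact_op K" and "\<delta> > 0"
    and indep: "\<And>n. v n \<notin> cspan (v ` {..<n})"
    and tri: "\<And>n. K (v n) - \<kappa> n *\<^sub>C v n \<in> cspan (v ` {..<n})"
    and \<kappa>: "\<And>n. \<delta> \<le> cmod (\<kappa> n)"
  shows False
proof -
  define M where "M n = cspan (v ` {..<n})" for n
  have M_sub: "csubspace (M n)" for n unfolding M_def by (rule complex_vector.subspace_span)
  have M_mono: "M m \<subseteq> M n" if "m \<le> n" for m n
    unfolding M_def using that by (intro complex_vector.span_mono) auto
  have lin: "linear_op UNIV K" using K by (simp add: compact_op_def)
  have v_in: "v m \<in> M n" if "m < n" for m n
    unfolding M_def using that by (intro complex_vector.span_base) auto
  have K_inv: "K x \<in> M n" if "x \<in> M n" for x n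
  proof (rule linear_op_span_image[OF lin _ _ M_sub])
    show "x \<in> cspan (v ` {..<n})" using that by (simp add: M_def)
    fix y assume "y \<in> v ` {..<n}"
    then obtain m where m: "m < n" "y = v m" by auto
    have "(K (v m) - \<kappa> m *\<^sub>C v m) + \<kappa> m *\<^sub>C v m \<in> M n"
      using tri[of m] M_mono[of m n] m v_in[OF m(1)]
      by (intro complex_vector.subspace_add complex_vector.subspace_scale M_sub) (auto simp: M_def)
    then show "K y \<in> M n" using m by simp
  qed
  \<comment> \<open>The witness is the component of \<open>v n\<close> orthogonal to
    \<open>M n\<close>, scaled to norm 1. Since \<open>K\<close> maps \<open>M n\<close> into
    itself, subtracting the projection \<open>p\<close> preserves the triangular relation.\<close>
  have "\<exists>u. u \<in> M (Suc n) \<and> norm u = 1 \<and> K u - \<kappa> n *\<^sub>C u \<in> M n \<and> (\<forall>y\<in>M n. cinner y u = 0)" for n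
  proof -
    obtain p where p: "p \<in> M n" "\<forall>y\<in>M n. cinner (v n - p) y = 0"
      using projection_onto_finite_span[of "v ` {..<n}" "v n"] by (auto simp: M_def)
    define w where "w = v n - p"
    define c where "c = complex_of_real (1 / norm w)"
    have w: "w \<noteq> 0" using p(1) indep[of n] by (auto simp: w_def M_def)
    have "w \<in> M (Suc n)"
      unfolding w_def using p(1) M_mono[of n "Suc n"] v_in[of n "Suc n"]
      by (intro complex_vector.subspace_diff M_sub) auto
    moreover have "K w - \<kappa> n *\<^sub>C w \<in> M n"
    proof -
      have "(K (v n) - \<kappa> n *\<^sub>C v n) - (K p - \<kappa> n *\<^sub>C p) \<in> M n"
        using tri[of n] p(1) K_inv[OF p(1)] unfolding M_def[symmetric]
        by (metis complex_vector.subspace_diff complex_vector.subspace_scale M_sub)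
      moreover have "K w - \<kappa> n *\<^sub>C w = (K (v n) - \<kappa> n *\<^sub>C v n) - (K p - \<kappa> n *\<^sub>C p)"
        by (simp add: w_def linear_op_diff[OF lin] scaleC.diff_right)
      ultimately show ?thesis by simp
    qed
    moreover have "K (c *\<^sub>C w) - \<kappa> n *\<^sub>C c *\<^sub>C w = c *\<^sub>C (K w - \<kappa> n *\<^sub>C w)"
      by (simp add: linear_opD(3)[OF lin] scaleC.diff_right scaleC_scaleC mult.commute)
    moreover have "\<forall>y\<in>M n. cinner y (c *\<^sub>C w) = 0"
      using p(2) by (simp add: cinner_scaleC_right w_def cinner_eq_zero_commute[of _ "v n - p"])
    moreover have "norm (c *\<^sub>C w) = 1" using w by (simp add: c_def norm_divide)
    ultimately show ?thesis
      by (intro exI[of _ "c *\<^sub>C w"]) (auto intro: complex_vector.subspace_scale[OF M_sub])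
  qed
  then obtain u where u: "\<And>n. u n \<in> M (Suc n)" "\<And>n. norm (u n) = 1"
    "\<And>n. K (u n) - \<kappa> n *\<^sub>C u n \<in> M n" "\<And>n y. y \<in> M n \<Longrightarrow> cinner y (u n) = 0"
    by metis
  have "\<delta> \<le> norm (K (u n) - K (u m))" if "m < n" for m n
  proof -
    have "K (u m) \<in> M n" using K_inv u(1)[of m] M_mono[of "Suc m" n] that by auto
    \<comment> \<open>The inner product with \<open>u n\<close> isolates the diagonal entry:
      everything else lies in \<open>M n\<close>, which is orthogonal to \<open>u n\<close>.\<close>
    then have "cinner (K (u n) - K (u m)) (u n)
        = cinner (K (u n) - \<kappa> n *\<^sub>C u n) (u n) + \<kappa> n * cinner (u n) (u n)"
      by (simp add: cinner.diff_left cinner_scaleC_left u(4))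
    then have "cinner (K (u n) - K (u m)) (u n) = \<kappa> n"
      using u(2)[of n] by (simp add: u(3,4) cinner_self)
    then show ?thesis
      using norm_cinner_le[of "K (u n) - K (u m)" "u n"] u(2)[of n] \<kappa>[of n] by simp
  qed
  moreover have "bounded (range u)" using u(2) by (auto simp: bounded_iff)
  ultimately show False using compact_op_not_separated[OF K _ \<open>\<delta> > 0\<close>] by blast
qed

section \<open>Riesz theory: invertibility of \<open>1 - K\<close> for compact
  \<open>K\<close>\<close>

lemma riesz_almost_orthogonal:
  fixes Y :: "'b::real_normed_vector set"
  assumes "closed Y" "subspace Y" "x \<notin> Y"
  shows "\<exists>p\<in>Y. \<forall>y\<in>Y. norm (x - p) / 2 \<le> norm (x - p - y)"
proof -
  define d where "d = infdist x Y"
  have ne: "Y \<noteq> {}" using subspace_0[OF assms(2)] by auto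
  have "d > 0" unfolding d_def using assms ne by (intro infdist_pos_not_in_closed)
  \<comment> \<open>It is enough that \<open>p\<close> comes within a factor 2 of the distance
    \<open>d\<close>: since \<open>Y\<close> is a subspace, \<open>x - p - y\<close> still has norm
    at least \<open>d\<close>.\<close>
  have "\<exists>p\<in>Y. dist x p < 2 * d"
  proof (rule ccontr)
    assume "\<not> (\<exists>p\<in>Y. dist x p < 2 * d)"
    then have "2 * d \<le> infdist x Y"
      using ne by (auto simp: infdist_notempty not_less intro!: cINF_greatest)
    then show False using \<open>d > 0\<close> by (simp add: d_def)
  qed
  then obtain p where p: "p \<in> Y" "norm (x - p) < 2 * d" by (auto simp: dist_norm)
  have "norm (x - p) / 2 \<le> norm (x - p - y)" if "y \<in> Y" for y
  proof -
    have "d \<le> dist x (p + y)"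
      unfolding d_def by (intro infdist_le subspace_add assms p that)
    then show ?thesis using p(2) by (simp add: dist_norm diff_diff_eq)
  qed
  with p(1) show ?thesis by blast
qed

text \<open>Otherwise there are unit vectors \<open>u n\<close> with \<open>u n - K (u n)\<close>
  tending to 0. Along a subsequence \<open>K (u n)\<close> converges, hence so does
  \<open>u n\<close>, and the limit is a unit vector fixed by \<open>K\<close>.\<close>

lemma compact_op_injective_bounded_below:
  assumes K: "compact_op K" and inj: "\<And>x. K x = x \<Longrightarrow> x = 0"
  shows "\<exists>\<delta>>0. \<forall>x. \<delta> * norm x \<le> norm (x - K x)"
proof (rule ccontr)
  assume neg: "\<not> ?thesis"
  interpret K: bounded_linear K by (rule compact_op_bounded_linear[OF K])
  have "\<exists>x. norm x = 1 \<and> norm (x - K x) < inverse (real (Suc n))" for n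
  proof -
    have "inverse (real (Suc n)) > 0" by simp
    then obtain x where x: "norm (x - K x) < inverse (real (Suc n)) * norm x"
      using neg by (meson not_le)
    have "x \<noteq> 0" using x by (auto simp: K.zero)
    define y where "y = (1 / norm x) *\<^sub>R x"
    have "y - K y = (1 / norm x) *\<^sub>R (x - K x)"
      by (simp add: y_def K.scaleR scaleR_diff_right)
    then have "norm (y - K y) < inverse (real (Suc n))"
      using x \<open>x \<noteq> 0\<close> by (simp add: divide_simps mult.commute del: of_nat_Suc)
    moreover have "norm y = 1" using \<open>x \<noteq> 0\<close> by (simp add: y_def)
    ultimately show ?thesis by blast
  qed
  then obtain u where u: "\<And>n. norm (u n) = 1"
    "\<And>n. norm (u n - K (u n)) < inverse (real (Suc n))" by metis
  have "bounded (range u)" using u(1) by (auto simp: bounded_iff)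
  then obtain r l where r: "strict_mono (r::nat \<Rightarrow> nat)" and l: "(\<lambda>n. K (u (r n))) \<longlonglongrightarrow> l"
    using compact_op_convergent_subseq[OF K] by blast
  have "(\<lambda>n. u n - K (u n)) \<longlonglongrightarrow> 0"
    by (rule Lim_null_comparison[OF _ LIMSEQ_inverse_real_of_nat])
       (use u(2) in \<open>auto intro!: always_eventually less_imp_le simp del: of_nat_Suc\<close>)
  then have "(\<lambda>n. u (r n) - K (u (r n))) \<longlonglongrightarrow> 0"
    using LIMSEQ_subseq_LIMSEQ[OF _ r] by (fastforce simp: o_def)
  from tendsto_add[OF this l] have ul: "(\<lambda>n. u (r n)) \<longlonglongrightarrow> l" by simp
  then have "(\<lambda>n. K (u (r n))) \<longlonglongrightarrow> K l" by (rule K.tendsto)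
  then have "K l = l" using l LIMSEQ_unique by blast
  then have "l = 0" by (rule inj)
  moreover have "norm l = 1"
    using tendsto_norm[OF ul] u(1) by (simp add: LIMSEQ_const_iff)
  ultimately show False by simp
qed

text \<open>If \<open>1 - K\<close> were not onto, the ranges of its powers would form a strictly decreasing chain of
  closed subspaces; almost orthogonal vectors in consecutive ranges have separated images under
  \<open>K\<close>.\<close>

lemma compact_op_injective_imp_surjective:
  assumes K: "compact_op K" and inj: "\<And>x. K x = x \<Longrightarrow> x = 0"
  shows "\<exists>x. x - K x = y"
proof (rule ccontr)
  assume neg: "\<not> ?thesis"
  interpret K: bounded_linear K by (rule compact_op_bounded_linear[OF K])
  define A where "A x = x - K x" for x
  interpret A: bounded_linear A
    unfolding A_def by (intro bounded_linear_sub bounded_linear_ident K.bounded_linear_axioms)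
  obtain \<delta> where \<delta>: "\<delta> > 0" "\<And>x. \<delta> * norm x \<le> norm (A x)"
    using compact_op_injective_bounded_below[OF K inj] by (auto simp: A_def)
  have A_inj: "a = b" if "A a = A b" for a b
    using inj[of "a - b"] that by (simp add: A_def K.diff algebra_simps)
  define N where "N k = range (A ^^ k)" for k
  have N_Suc: "N (Suc k) = A ` N k" for k
    by (auto simp: N_def image_iff)
  have N_props: "subspace (N k) \<and> complete (N k)" for k
  proof (induction k)
    case 0
    then show ?case by (simp add: N_def complete_UNIV)
  next
    case (Suc k)
    then show ?case unfolding N_Suc
      by (intro conjI linear_subspace_image[OF A.linear_axioms]
          complete_isometric_image[OF \<delta>(1)] A.bounded_linear_axioms) (auto simp: \<delta>(2))
  qed
  have N_dec: "N (Suc k) \<subseteq> N k" for k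
    unfolding N_def by (auto simp: funpow_Suc_right simp del: funpow.simps)
  have N_anti: "N l \<subseteq> N k" if "k \<le> l" for k l
    using N_dec that by (rule lift_Suc_antimono_le)
  \<comment> \<open>The vector \<open>y\<close> missed by \<open>A\<close> makes the chain strict:
    by injectivity, a failure at \<open>Suc k\<close> would give a failure at
    \<open>k\<close>.\<close>
  have "(A ^^ k) y \<notin> N (Suc k)" for k
  proof (induction k)
    case 0
    then show ?case using neg by (auto simp: N_def A_def)
  next
    case (Suc k)
    show ?case
    proof
      assume "(A ^^ Suc k) y \<in> N (Suc (Suc k))"
      then obtain z where "z \<in> N (Suc k)" "A ((A ^^ k) y) = A z"
        by (auto simp: N_Suc[of "Suc k"])
      with A_inj Suc show False by blast
    qed
  qed
  then have "\<exists>u\<in>N k. norm u = 1 \<and> (\<forall>z\<in>N (Suc k). 1 / 2 \<le> norm (u - z))" for k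
  proof -
    have x: "(A ^^ k) y \<notin> N (Suc k)" by fact
    obtain p where p: "p \<in> N (Suc k)"
      "\<And>z. z \<in> N (Suc k) \<Longrightarrow> norm ((A ^^ k) y - p) / 2 \<le> norm ((A ^^ k) y - p - z)"
      using riesz_almost_orthogonal[OF complete_imp_closed _ x] N_props[of "Suc k"] by blast
    define w where "w = (A ^^ k) y - p"
    have w: "w \<noteq> 0" using x p(1) by (auto simp: w_def)
    have "w \<in> N k"
      unfolding w_def using p(1) N_dec N_props[of k] by (intro subspace_diff) (auto simp: N_def)
    then have "(1 / norm w) *\<^sub>R w \<in> N k" using N_props[of k] subspace_scale by blast
    moreover have "1 / 2 \<le> norm ((1 / norm w) *\<^sub>R w - z)" if "z \<in> N (Suc k)" for z
    proof -
      have "norm w *\<^sub>R z \<in> N (Suc k)" using N_props[of "Suc k"] that subspace_scale by blast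
      then have "norm w / 2 \<le> norm (w - norm w *\<^sub>R z)" using p(2) by (simp add: w_def)
      also have "w - norm w *\<^sub>R z = norm w *\<^sub>R ((1 / norm w) *\<^sub>R w - z)"
        using w by (simp add: scaleR_diff_right)
      finally show ?thesis using w by simp
    qed
    ultimately show ?thesis
      using w by (intro bexI[of _ "(1 / norm w) *\<^sub>R w"]) auto
  qed
  then obtain u where u: "\<And>k. u k \<in> N k" "\<And>k. norm (u k) = 1"
    "\<And>k z. z \<in> N (Suc k) \<Longrightarrow> 1 / 2 \<le> norm (u k - z)" by metis
  have "1 / 2 \<le> norm (K (u n) - K (u m))" if "m < n" for m n
  proof -
    have mem: "u n \<in> N (Suc m)" "A (u m) \<in> N (Suc m)" "A (u n) \<in> N (Suc m)"
      using u(1) N_anti[of "Suc m" n] N_anti[of "Suc m" "Suc n"] that by (auto simp: N_Suc)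
    \<comment> \<open>From \<open>K = 1 - A\<close> follows
      \<open>K (u m) - K (u n) = u m - (A (u m) + u n - A (u n))\<close>, and the bracket lies in
      \<open>N (Suc m)\<close>.\<close>
    have "A (u m) + u n - A (u n) \<in> N (Suc m)"
      using N_props[of "Suc m"] mem by (intro subspace_diff subspace_add) auto
    from u(3)[OF this] show ?thesis
      by (simp add: A_def norm_minus_commute algebra_simps)
  qed
  moreover have "bounded (range u)" using u(2) by (auto simp: bounded_iff)
  ultimately show False using compact_op_not_separated[OF K, of u "1/2"] by simp
qed

section \<open>Operators with a compact resolvent\<close>

text \<open>\<open>G\<close> is the resolvent of \<open>T\<close> at \<open>z0\<close>, given by the
  equations of a two-sided inverse between \<open>S\<close> and the whole space.\<close>

locale compact_inverse =
  fixes S :: "'a::complex_hilbert_space set" and T G :: "'a \<Rightarrow> 'a" and z0 :: complex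
  assumes T: "linear_op S T"
    and G: "compact_op G"
    and G_dom: "G f \<in> S"
    and T_G: "T (G f) - z0 *\<^sub>C G f = f"
    and G_T: "x \<in> S \<Longrightarrow> G (T x - z0 *\<^sub>C x) = x"
begin

lemma G_lin: "linear_op UNIV G"
  using G by (simp add: compact_op_def)

text \<open>After composition with \<open>G\<close>, on either side, \<open>T - z\<close> becomes
  \<open>1 - (z - z0) G\<close>. This reduces spectral questions about \<open>T\<close> to compact
  operators.\<close>

lemma T_shift_G: "T (G f) - z *\<^sub>C G f = f - (z - z0) *\<^sub>C G f"
  using T_G[of f] by (simp add: scaleC.diff_left algebra_simps)

lemma G_T_shift:
  assumes "x \<in> S"
  shows "G (T x - z *\<^sub>C x) = x - (z - z0) *\<^sub>C G x"
proof -
  have "T x - z *\<^sub>C x = (T x - z0 *\<^sub>C x) - (z - z0) *\<^sub>C x"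
    by (simp add: scaleC.diff_left)
  then show ?thesis
    by (simp only: linear_op_diff[OF G_lin] linear_opD(3)[OF G_lin] G_T[OF assms] UNIV_I)
qed

lemma shift_linear: "linear_op S (\<lambda>x. T x - z *\<^sub>C x)"
  using T by (auto simp: linear_op_def scaleC_add_right scaleC.diff_right scaleC_scaleC mult.commute)

text \<open>If \<open>z\<close> is no eigenvalue, then \<open>K = (z - z0) G\<close> fixes no
  nonzero vector. Riesz theory makes \<open>1 - K\<close> surjective and bounded below, which gives
  a solution \<open>G g\<close> of \<open>(T - z) x = f\<close> and a bound for the inverse of
  \<open>T - z\<close>.\<close>

lemma spectrum_imp_eigenvalue:
  assumes "z \<in> op_spectrum S T"
  shows "eigenvalue_op S T z"
proof (rule ccontr)
  assume neg: "\<not> eigenvalue_op S T z"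
  define c where "c = z - z0"
  define K where "K x = c *\<^sub>C G x" for x
  have K: "compact_op K" unfolding K_def by (rule compact_op_scale[OF G])
  have S: "csubspace S" using T by (rule linear_opD)
  have inj: "x = 0" if "K x = x" for x
  proof (rule ccontr)
    assume "x \<noteq> 0"
    have "x = G (c *\<^sub>C x)" using that by (simp add: K_def linear_opD(3)[OF G_lin])
    then have "x \<in> S" "T x - z0 *\<^sub>C x = c *\<^sub>C x"
      using G_dom T_G by metis+
    then have "T x = z *\<^sub>C x" by (simp add: c_def scaleC.diff_left algebra_simps)
    with neg \<open>x \<noteq> 0\<close> \<open>x \<in> S\<close> show False by (auto simp: eigenvalue_op_def)
  qed
  obtain \<delta> where \<delta>: "\<delta> > 0" "\<And>x. \<delta> * norm x \<le> norm (x - K x)"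
    using compact_op_injective_bounded_below[OF K inj] by blast
  define A where "A x = T x - z *\<^sub>C x" for x
  have A_lin: "linear_op S A" unfolding A_def by (rule shift_linear)
  have A_inj: "inj_on A S"
  proof (rule inj_onI)
    fix x y assume xy: "x \<in> S" "y \<in> S" "A x = A y"
    have "A (x - y) = 0" using linear_op_diff[OF A_lin] xy by simp
    moreover have "x - y \<in> S" using S xy complex_vector.subspace_diff by blast
    ultimately have "G 0 = (x - y) - K (x - y)"
      using G_T_shift[of "x - y" z] by (simp add: A_def K_def c_def)
    then show "x = y" using inj[of "x - y"] linear_op_zero[OF G_lin] by simp
  qed
  have A_surj: "f \<in> A ` S" for f
  proof -
    obtain g where "g - K g = f" using compact_op_injective_imp_surjective[OF K inj] by blast
    then have "A (G g) = f" by (simp add: A_def T_shift_G K_def c_def)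
    then show ?thesis using G_dom by blast
  qed
  define V where "V = the_inv_into S A"
  have V: "V f \<in> S" "A (V f) = f" for f
    unfolding V_def using A_inj A_surj
    by (auto intro: the_inv_into_into f_the_inv_into_f)
  have V_eqI: "V f = x" if "x \<in> S" "A x = f" for f x
    using inj_onD[OF A_inj] V that by metis
  obtain C where C: "\<And>x. norm (G x) \<le> norm x * C"
    using bounded_linear.bounded[OF compact_op_bounded_linear[OF G]] by blast
  have "bounded_linear V"
  proof (rule bounded_linear_intro[where K = "C / \<delta>"])
    show "V (x + y) = V x + V y" for x y
      using V linear_opD[OF A_lin] S by (intro V_eqI) (auto intro: complex_vector.subspace_add)
    show "V (r *\<^sub>R x) = r *\<^sub>R V x" for r x
      unfolding scaleC_of_real[symmetric]
      using V linear_opD[OF A_lin] S by (intro V_eqI) (auto intro: complex_vector.subspace_scale)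
    show "norm (V x) \<le> norm x * (C / \<delta>)" for x
    proof -
      have "V x - K (V x) = G x"
        using G_T_shift[OF V(1), of x z] V(2)[of x] by (simp add: A_def K_def c_def)
      then have "\<delta> * norm (V x) \<le> norm x * C" using \<delta>(2)[of "V x"] C[of x] by simp
      then show ?thesis using \<delta>(1) by (simp add: field_simps)
    qed
  qed
  moreover have "bij_betw A S UNIV" using A_inj A_surj by (auto simp: bij_betw_def)
  ultimately have "z \<in> resolvent_set S T"
    by (simp add: resolvent_set_def resolvent_def V_def A_def[abs_def])
  then show False using assms by (simp add: op_spectrum_def)
qed

lemma eigenvector_G:
  assumes "x \<in> S" "T x = z *\<^sub>C x"
  shows "x = (z - z0) *\<^sub>C G x"
proof -
  have "x - (z - z0) *\<^sub>C G x = G (T x - z *\<^sub>C x)"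
    by (rule G_T_shift[OF assms(1), symmetric])
  also have "\<dots> = 0" by (simp add: assms(2) linear_op_zero[OF G_lin])
  finally show ?thesis by (rule eq_iff_diff_eq_0[THEN iffD2])
qed

text \<open>Distinct eigenvalues of \<open>T\<close> within distance \<open>M\<close> of
  \<open>z0\<close> give distinct eigenvalues \<open>\<kappa> n\<close> of \<open>G\<close> of
  modulus at least \<open>1 / M\<close>. Infinitely many of them would make \<open>G\<close>
  triangular, even diagonal, along an independent sequence.\<close>

lemma finite_eigenvalues_in_ball: "finite {z. eigenvalue_op S T z \<and> cmod (z - z0) \<le> M}"
proof (rule ccontr)
  assume "infinite {z. eigenvalue_op S T z \<and> cmod (z - z0) \<le> M}"
  then obtain \<zeta> :: "nat \<Rightarrow> complex" where "inj \<zeta>"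
    and \<zeta>: "range \<zeta> \<subseteq> {z. eigenvalue_op S T z \<and> cmod (z - z0) \<le> M}"
    using infinite_countable_subset by blast
  have "\<forall>n. \<exists>x\<in>S. x \<noteq> 0 \<and> T x = \<zeta> n *\<^sub>C x" using \<zeta> by (auto simp: eigenvalue_op_def)
  then obtain v where v: "\<And>n. v n \<in> S" "\<And>n. v n \<noteq> 0" "\<And>n. T (v n) = \<zeta> n *\<^sub>C v n" by metis
  have vG: "v n = (\<zeta> n - z0) *\<^sub>C G (v n)" for n by (rule eigenvector_G[OF v(1) v(3)])
  define \<kappa> where "\<kappa> n = 1 / (\<zeta> n - z0)" for n
  have nz: "\<zeta> n - z0 \<noteq> 0" for n
    using vG[of n] v(2)[of n] by (metis complex_vector.scale_zero_left)
  have Gv: "G (v n) = \<kappa> n *\<^sub>C v n" for n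
    using vG[of n] nz[of n] by (metis \<kappa>_def complex_vector.scale_one complex_vector.scale_scale nonzero_eq_divide_eq)
  have \<kappa>_inj: "\<kappa> m \<noteq> \<kappa> n" if "m \<noteq> n" for m n
    using that nz[of m] nz[of n] \<open>inj \<zeta>\<close> by (auto simp: \<kappa>_def inj_eq)
  \<comment> \<open>\<open>p n\<close> is the product of the operators \<open>G - \<kappa> j\<close>
    over \<open>j < n\<close>: it annihilates \<open>v i\<close> for \<open>i < n\<close> but not
    \<open>v n\<close>, which proves independence.\<close>
  define p where "p n = rec_nat (\<lambda>x. x) (\<lambda>k q x. G (q x) - \<kappa> k *\<^sub>C q x) n" for n
  have p_0: "p 0 x = x" and p_Suc: "p (Suc n) x = G (p n x) - \<kappa> n *\<^sub>C p n x" for n x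
    by (simp_all add: p_def)
  have p_lin: "linear_op UNIV (p n)" for n
  proof (induction n)
    case (Suc n)
    then show ?case
      using G_lin by (auto simp: linear_op_def p_Suc scaleC_add_right scaleC.diff_right scaleC_scaleC mult.commute)
  qed (simp add: linear_op_def p_0)
  have p_v: "p n (v i) = (\<Prod>j<n. \<kappa> i - \<kappa> j) *\<^sub>C v i" for n i
  proof (induction n)
    case (Suc n)
    then show ?case
      by (simp add: p_Suc linear_opD(3)[OF G_lin] Gv algebra_simps)
  qed (simp add: p_0)
  have indep: "v n \<notin> cspan (v ` {..<n})" for n
  proof
    assume "v n \<in> cspan (v ` {..<n})"
    then have "p n (v n) \<in> {0}"
      by (rule linear_op_span_image[OF p_lin]) (auto simp: p_v prod_zero_iff)
    then show False using v(2)[of n] \<kappa>_inj by (auto simp: p_v)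
  qed
  have \<zeta>_pos: "0 < cmod (\<zeta> n - z0)" and \<zeta>_le: "cmod (\<zeta> n - z0) \<le> M" for n
    using nz[of n] \<zeta> by auto
  have "M > 0" using \<zeta>_pos \<zeta>_le by (rule less_le_trans)
  show False
  proof (rule compact_op_no_triangular_sequence[OF G _ indep, where \<kappa> = \<kappa> and \<delta> = "1 / M"])
    show "1 / M \<le> cmod (\<kappa> n)" for n
      unfolding \<kappa>_def norm_divide norm_one by (intro frac_le \<zeta>_pos \<zeta>_le) simp_all
  qed (simp_all add: \<open>M > 0\<close> Gv complex_vector.span_zero)
qed

text \<open>On \<open>S\<close>, applying \<open>T - z\<close> and then \<open>G\<close> is the same
  as applying \<open>A = 1 - (z - z0) G\<close>, and \<open>A\<close> commutes with
  \<open>G\<close>. Each factor \<open>T - z\<close> can thus be traded for a factor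
  \<open>A\<close>.\<close>

lemma ker_power_G:
  assumes "x \<in> ker_power S T z k"
  shows "((\<lambda>x. x - (z - z0) *\<^sub>C G x) ^^ k) x = 0"
  using assms
proof (induction k arbitrary: x)
  case (Suc k)
  define A where "A = (\<lambda>x. x - (z - z0) *\<^sub>C G x)"
  have comm: "A (G y) = G (A y)" for y
    by (simp add: A_def linear_op_diff[OF G_lin] linear_opD(3)[OF G_lin])
  have comm_pow: "(A ^^ k) (G y) = G ((A ^^ k) y)" for k y
    by (induction k) (simp_all add: comm)
  have "A x = G (T x - z *\<^sub>C x)" using Suc.prems by (simp add: A_def G_T_shift)
  then have "(A ^^ Suc k) x = G ((A ^^ k) (T x - z *\<^sub>C x))"
    by (simp add: funpow_Suc_right comm_pow del: funpow.simps)
  also have "\<dots> = 0"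
    using Suc by (simp add: A_def linear_op_zero[OF G_lin])
  finally show ?case by (simp add: A_def)
qed simp

text \<open>If no finite set spans the root vectors, a sequence \<open>v\<close> can be chosen with
  \<open>v n\<close> outside the span of its predecessors and \<open>A (v n)\<close> inside. Then
  \<open>G\<close> is triangular with constant diagonal \<open>1 / c\<close>, contrary to
  compactness.\<close>

lemma finite_root_subspace: "\<exists>B. finite B \<and> (\<Union>k. ker_power S T z k) \<subseteq> cspan B"
proof (rule ccontr)
  assume neg: "\<not> ?thesis"
  define c where "c = z - z0"
  define A where "A = (\<lambda>x. x - c *\<^sub>C G x)"
  have step: "\<exists>w. w \<notin> cspan B \<and> A w \<in> cspan B" if "finite B" for B
  proof -
    have "\<not> (\<Union>k. ker_power S T z k) \<subseteq> cspan B" using neg that by meson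
    then obtain x k where x: "x \<in> ker_power S T z k" "x \<notin> cspan B" by (meson UN_E subsetI)
    have "(A ^^ k) x \<in> cspan B"
      using ker_power_G[OF x(1)] by (simp add: A_def c_def complex_vector.span_zero)
    \<comment> \<open>Some power of \<open>A\<close> kills \<open>x\<close>; the witness is the
      iterate just before the first one inside the span.\<close>
    then obtain j where j: "(A ^^ j) x \<in> cspan B" "\<And>i. i < j \<Longrightarrow> (A ^^ i) x \<notin> cspan B"
      using exists_least_iff[of "\<lambda>j. (A ^^ j) x \<in> cspan B"] by blast
    have "j \<noteq> 0" using j(1) x(2) by (cases j) auto
    then obtain i where "j = Suc i" using not0_implies_Suc by blast
    then show ?thesis using j by (intro exI[of _ "(A ^^ i) x"]) auto
  qed
  have "\<exists>v. \<forall>n. v n \<notin> cspan (v ` {..<n}) \<and> A (v n) \<in> cspan (v ` {..<n::nat})"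
  proof (rule dependent_wellorder_choice)
    fix r and f g :: "nat \<Rightarrow> 'a" and x
    assume "\<And>y. y < x \<Longrightarrow> f y = g y"
    then have "f ` {..<x} = g ` {..<x}" by auto
    then show "(r \<notin> cspan (f ` {..<x}) \<and> A r \<in> cspan (f ` {..<x})) =
        (r \<notin> cspan (g ` {..<x}) \<and> A r \<in> cspan (g ` {..<x}))" by simp
  qed (simp add: step)
  then obtain v :: "nat \<Rightarrow> 'a" where v: "\<And>n. v n \<notin> cspan (v ` {..<n})" "\<And>n. A (v n) \<in> cspan (v ` {..<n})" by metis
  \<comment> \<open>For \<open>c = 0\<close> the map \<open>A\<close> is the identity, and the two
    properties of \<open>v 0\<close> contradict each other.\<close>
  have "c \<noteq> 0" using v[of 0] by (auto simp: A_def)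
  have "G (v n) - (1 / c) *\<^sub>C v n \<in> cspan (v ` {..<n})" for n
  proof -
    have "G (v n) - (1 / c) *\<^sub>C v n = (- 1 / c) *\<^sub>C A (v n)"
      using \<open>c \<noteq> 0\<close> by (simp add: A_def scaleC.diff_right scaleC.minus_left)
    then show ?thesis using v(2)[of n] by (simp only: complex_vector.span_scale)
  qed
  then show False
    using compact_op_no_triangular_sequence[OF G _ v(1), of "cmod (1 / c)" "\<lambda>_. 1 / c"] \<open>c \<noteq> 0\<close>
    by simp
qed

theorem discrete_spectrum: "discrete_spectrum S T"
  unfolding discrete_spectrum_def
proof (intro conjI allI ballI)
  fix z
  show "\<not> z islimpt op_spectrum S T"
  proof
    assume "z islimpt op_spectrum S T"
    then have "infinite (op_spectrum S T \<inter> ball z 1)"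
      by (simp add: islimpt_eq_infinite_ball)
    moreover have "op_spectrum S T \<inter> ball z 1
        \<subseteq> {w. eigenvalue_op S T w \<and> cmod (w - z0) \<le> cmod (z - z0) + 1}"
    proof clarsimp
      fix w assume w: "w \<in> op_spectrum S T" "dist z w < 1"
      have "cmod (w - z0) \<le> cmod (z - z0) + dist z w"
        using norm_triangle_ineq[of "z - z0" "w - z"] by (simp add: dist_norm norm_minus_commute)
      then show "eigenvalue_op S T w \<and> cmod (w - z0) \<le> cmod (z - z0) + 1"
        using w spectrum_imp_eigenvalue by auto
    qed
    ultimately show False using finite_eigenvalues_in_ball finite_subset by blast
  qed
qed (simp_all add: spectrum_imp_eigenvalue finite_root_subspace)

end

section \<open>Operators diagonal in an orthonormal basis\<close>

locale orthonormal_sequence_basis =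
  fixes b :: "nat \<Rightarrow> 'a::complex_hilbert_space"
  assumes cinner_b: "cinner (b m) (b n) = (if m = n then 1 else 0)"
    and dense: "closure (cspan (range b)) = UNIV"
begin

lemma coef_eqI:
  assumes "\<And>m. cinner x (b m) = cinner y (b m)"
  shows "x = y"
proof (rule cinner_dense_eqI[OF dense])
  fix z assume "z \<in> cspan (range b)"
  then have "cinner (x - y) z = 0"
    by (rule cinner_span_eq_zero[rotated]) (use assms in \<open>auto simp: cinner.diff_left\<close>)
  then show "cinner z x = cinner z y"
    by (simp add: cinner_eq_zero_commute[of "x - y"] cinner.diff_right)
qed

lemma norm_b [simp]: "norm (b m) = 1"
proof -
  have "(norm (b m))\<^sup>2 = 1"
    using cinner_self[of "b m"] cinner_b[of m m] by (metis of_real_eq_1_iff)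
  then show ?thesis by (simp add: abs_square_eq_1)
qed

lemma cinner_sum_b:
  assumes "finite F"
  shows "cinner (\<Sum>m\<in>F. c m *\<^sub>C b m) (b k) = (if k \<in> F then c k else 0)"
proof -
  have "cinner (\<Sum>m\<in>F. c m *\<^sub>C b m) (b k) = (\<Sum>m\<in>F. if m = k then c k else 0)"
    unfolding cinner.sum_left by (rule sum.cong) (auto simp: cinner_scaleC_left cinner_b)
  then show ?thesis using assms by simp
qed

lemma norm_sum_b:
  assumes "finite F"
  shows "(norm (\<Sum>m\<in>F. c m *\<^sub>C b m))\<^sup>2 = (\<Sum>m\<in>F. (cmod (c m))\<^sup>2)"
proof -
  have "complex_of_real ((norm (\<Sum>m\<in>F. c m *\<^sub>C b m))\<^sup>2)
      = (\<Sum>k\<in>F. cinner (\<Sum>m\<in>F. c m *\<^sub>C b m) (c k *\<^sub>C b k))"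
    unfolding cinner_self[symmetric] by (rule cinner.sum_right)
  also have "\<dots> = (\<Sum>k\<in>F. complex_of_real ((cmod (c k))\<^sup>2))"
    using assms by (intro sum.cong)
      (simp_all add: cinner_scaleC_right cinner_sum_b complex_norm_square mult.commute del: of_real_power)
  finally show ?thesis by (metis of_real_eq_iff of_real_sum)
qed

text \<open>The partial sum \<open>p\<close> of the expansion satisfies
  \<open>cinner h p = norm p ^ 2\<close>, so Cauchy-Schwarz gives
  \<open>norm p \<le> norm h\<close>.\<close>

lemma bessel: "(\<Sum>m<N. (cmod (cinner h (b m)))\<^sup>2) \<le> (norm h)\<^sup>2"
proof -
  define p where "p = (\<Sum>m<N. cinner h (b m) *\<^sub>C b m)"
  have "cinner h p = complex_of_real ((norm p)\<^sup>2)"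
    unfolding p_def norm_sum_b[OF finite_lessThan] cinner.sum_right
    by (simp add: cinner_scaleC_right complex_norm_square mult.commute del: of_real_power)
  then have "(norm p)\<^sup>2 \<le> norm h * norm p"
    using norm_cinner_le[of h p] by (simp add: norm_power)
  then have "norm p \<le> norm h"
    by (cases "p = 0") (simp_all add: power2_eq_square)
  then have "(norm p)\<^sup>2 \<le> (norm h)\<^sup>2" by (simp add: power_mono)
  then show ?thesis by (simp add: p_def norm_sum_b)
qed

text \<open>Riesz-Fischer: by Pythagoras the squared norm of a block of the series is a block of the
  convergent series of squares.\<close>

lemma sums_b:
  assumes "\<And>N. (\<Sum>m<N. (cmod (c m))\<^sup>2) \<le> B\<^sup>2" "B \<ge> 0"
  shows "summable (\<lambda>m. c m *\<^sub>C b m)" "norm (\<Sum>m. c m *\<^sub>C b m) \<le> B"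
proof -
  have sm: "summable (\<lambda>m. (cmod (c m))\<^sup>2)"
    by (rule summableI_nonneg_bounded[OF _ assms(1)]) simp
  show s: "summable (\<lambda>m. c m *\<^sub>C b m)"
    unfolding summable_Cauchy
  proof (intro allI impI)
    fix \<epsilon> :: real assume "\<epsilon> > 0"
    then obtain N where N: "\<And>m n. m \<ge> N \<Longrightarrow> norm (\<Sum>i = m..<n. (cmod (c i))\<^sup>2) < \<epsilon>\<^sup>2"
      using sm unfolding summable_Cauchy by (meson zero_less_power)
    have "norm (\<Sum>i = m..<n. c i *\<^sub>C b i) < \<epsilon>" if "m \<ge> N" for m n
    proof -
      have "(norm (\<Sum>i = m..<n. c i *\<^sub>C b i))\<^sup>2 < \<epsilon>\<^sup>2"
        using N[OF that, of n] by (simp add: norm_sum_b sum_nonneg)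
      then show ?thesis using \<open>\<epsilon> > 0\<close> by (simp add: power2_less_imp_less)
    qed
    then show "\<exists>N. \<forall>m\<ge>N. \<forall>n. norm (\<Sum>i = m..<n. c i *\<^sub>C b i) < \<epsilon>" by blast
  qed
  have "(\<lambda>N. norm (\<Sum>m<N. c m *\<^sub>C b m)) \<longlonglongrightarrow> norm (\<Sum>m. c m *\<^sub>C b m)"
    using s by (intro tendsto_norm summable_LIMSEQ)
  moreover have "norm (\<Sum>m<N. c m *\<^sub>C b m) \<le> B" for N
    using assms by (intro power2_le_imp_le[OF _ assms(2)]) (simp add: norm_sum_b)
  ultimately show "norm (\<Sum>m. c m *\<^sub>C b m) \<le> B"
    using LIMSEQ_le_const2 by blast
qed

text \<open>The resolvents and reduced resolvents of \<open>D\<close> used below all have this form.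
  The series converges for bounded \<open>c\<close>, the case treated next.\<close>

definition diag :: "(nat \<Rightarrow> complex) \<Rightarrow> 'a \<Rightarrow> 'a" where
  "diag c h = (\<Sum>m. (c m * cinner h (b m)) *\<^sub>C b m)"

context
  fixes c :: "nat \<Rightarrow> complex" and C :: real
  assumes c: "\<And>m. cmod (c m) \<le> C"
begin

lemma bound_nonneg: "C \<ge> 0"
  using norm_ge_zero c[of 0] by (rule order_trans)

lemma diag_coef_sum_le: "(\<Sum>m<N. (cmod (c m * cinner h (b m)))\<^sup>2) \<le> (C * norm h)\<^sup>2"
proof -
  have "(\<Sum>m<N. (cmod (c m * cinner h (b m)))\<^sup>2) \<le> (\<Sum>m<N. C\<^sup>2 * (cmod (cinner h (b m)))\<^sup>2)"
    unfolding norm_mult power_mult_distrib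
    by (intro sum_mono mult_right_mono power_mono c) simp_all
  also have "\<dots> \<le> (C * norm h)\<^sup>2"
    unfolding sum_distrib_left[symmetric] power_mult_distrib by (intro mult_left_mono bessel) simp
  finally show ?thesis .
qed

lemma diag_sums: "(\<lambda>m. (c m * cinner h (b m)) *\<^sub>C b m) sums diag c h"
  unfolding diag_def
  using sums_b(1)[OF diag_coef_sum_le mult_nonneg_nonneg[OF bound_nonneg norm_ge_zero]]
  by (rule summable_sums)

lemma norm_diag_le: "norm (diag c h) \<le> C * norm h"
  unfolding diag_def
  by (rule sums_b(2)[OF diag_coef_sum_le mult_nonneg_nonneg[OF bound_nonneg norm_ge_zero]])

lemma cinner_diag: "cinner (diag c h) (b k) = c k * cinner h (b k)"
proof -
  have "(\<lambda>m. cinner ((c m * cinner h (b m)) *\<^sub>C b m) (b k)) sums cinner (diag c h) (b k)"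
    by (rule bounded_linear.sums[OF cinner.bounded_linear_left diag_sums])
  moreover have "(\<lambda>m. cinner ((c m * cinner h (b m)) *\<^sub>C b m) (b k))
      = (\<lambda>m. if m = k then c m * cinner h (b m) else 0)"
    by (auto simp: cinner_scaleC_left cinner_b)
  ultimately show ?thesis
    using sums_single[of k "\<lambda>m. c m * cinner h (b m)"] sums_unique2 by metis
qed

text \<open>Serves to move \<open>D\<close> across the series in \<open>diag_in_domain\<close>: both
  sides of the adjoint relation expand into the same series.\<close>

lemma cinner_diag_right_sums:
  "(\<lambda>m. cnj (c m * cinner h (b m)) * cinner x (b m)) sums cinner x (diag c h)"
  using bounded_linear.sums[OF cinner.bounded_linear_right diag_sums, of x h]
  by (simp add: cinner_scaleC_right)

lemma diag_linear: "linear_op UNIV (diag c)"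
  unfolding linear_op_def
  by (auto intro!: coef_eqI simp: cinner_diag cinner_add_left cinner_scaleC_left algebra_simps)

end

text \<open>A bounded sequence has a diagonal subsequence along which every basis coefficient
  converges. The images split into a head of finitely many coefficients, which converges, and a tail
  that is uniformly small because \<open>c\<close> tends to 0.\<close>

lemma compact_op_diag:
  assumes "c \<longlonglongrightarrow> 0"
  shows "compact_op (diag c)"
proof -
  obtain C where C: "\<And>m. cmod (c m) \<le> C"
    using convergent_imp_Bseq[OF convergentI[OF assms]] by (auto simp: Bseq_def)
  have "compact (closure (diag c ` B))" if "bounded B" for B
  proof (rule compact_closure_sequentialI)
    fix u :: "nat \<Rightarrow> 'a" assume "range u \<subseteq> diag c ` B"
    then have "\<forall>n. \<exists>w\<in>B. u n = diag c w" by blast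
    then obtain v where v: "\<And>n. v n \<in> B" "\<And>n. u n = diag c (v n)" by metis
    obtain M where M: "M > 0" "\<And>n. norm (v n) \<le> M"
      using \<open>bounded B\<close> v(1) by (meson bounded_pos)
    interpret subseqs "\<lambda>m s. convergent (\<lambda>n. cinner (v (s n)) (b m))"
    proof
      fix m :: nat and s :: "nat \<Rightarrow> nat"
      have "cmod (cinner (v (s n)) (b m)) \<le> M" for n
        using norm_cinner_le[of "v (s n)" "b m"] M(2)[of "s n"] by simp
      then have "bounded (range (\<lambda>n. cinner (v (s n)) (b m)))" by (auto simp: bounded_iff)
      then obtain l r where "strict_mono (r :: nat \<Rightarrow> nat)"
        "((\<lambda>n. cinner (v (s n)) (b m)) \<circ> r) \<longlonglongrightarrow> l"
        using bounded_imp_convergent_subsequence by blast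
      then show "\<exists>r. strict_mono r \<and> convergent (\<lambda>n. cinner (v ((s \<circ> r) n)) (b m))"
        by (auto simp: o_def convergent_def)
    qed
    have conv: "convergent (\<lambda>n. cinner (v (diagseq n)) (b m))" for m
    proof -
      have "convergent (\<lambda>n. cinner (v ((s \<circ> r) n)) (b k))"
        if "strict_mono r" "convergent (\<lambda>n. cinner (v (s n)) (b k))" for r s k
        using convergent_subseq_convergent[OF that(2,1)] by (simp add: o_def)
      \<comment> \<open>\<open>diagseq\<close> is a subsequence of the extraction made for
        coefficient \<open>m\<close> only from index \<open>Suc m\<close> on; an initial segment
        does not affect convergence.\<close>
      then have "convergent (\<lambda>n. cinner (v ((diagseq \<circ> (+) (Suc m)) n)) (b m))"
        by (rule diagseq_holds)
      then have "convergent (\<lambda>n. cinner (v (diagseq (n + Suc m))) (b m))"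
        by (simp add: o_def add.commute)
      then show ?thesis
        by (rule convergent_ignore_initial_segment[of _ "Suc m", THEN iffD1])
    qed
    define y where "y n = diag c (v (diagseq n))" for n
    have "Cauchy y"
    proof (rule metric_CauchyI)
      fix \<epsilon> :: real assume "\<epsilon> > 0"
      then have "\<epsilon> / (3 * M) > 0" using M(1) by simp
      with assms obtain N where N: "\<And>m. m \<ge> N \<Longrightarrow> cmod (c m) \<le> \<epsilon> / (3 * M)"
        unfolding LIMSEQ_iff by (metis diff_zero less_imp_le)
      \<comment> \<open>\<open>c'\<close> is the tail of \<open>c\<close>. The bound
        \<open>\<epsilon> / (3 * M)\<close> makes each of the two tail terms at most
        \<open>\<epsilon> / 3\<close>, which leaves \<open>\<epsilon> / 3\<close> for the
        head.\<close>
      define c' where "c' m = (if m < N then 0 else c m)" for m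
      have c': "cmod (c' m) \<le> \<epsilon> / (3 * M)" for m
        using N[of m] \<open>\<epsilon> / (3 * M) > 0\<close> by (auto simp: c'_def)
      define p where "p n = (\<Sum>m<N. (c m * cinner (v (diagseq n)) (b m)) *\<^sub>C b m)" for n
      have y_eq: "y n = p n + diag c' (v (diagseq n))" for n
        unfolding y_def p_def
        by (rule coef_eqI) (simp add: cinner_add_left cinner_diag[OF C] cinner_diag[OF c'] cinner_sum_b c'_def)
      have hi: "norm (diag c' (v n)) \<le> \<epsilon> / 3" for n
      proof -
        have "norm (diag c' (v n)) \<le> \<epsilon> / (3 * M) * M"
          using norm_diag_le[of c' "\<epsilon> / (3 * M)" "v n", OF c'] mult_left_mono[OF M(2)[of n], of "\<epsilon> / (3 * M)"] \<open>\<epsilon> / (3 * M) > 0\<close>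
          by linarith
        then show ?thesis using M(1) by simp
      qed
      have "\<exists>l. (\<lambda>n. cinner (v (diagseq n)) (b m)) \<longlonglongrightarrow> l" for m
        using conv by (simp add: convergent_def)
      then obtain a where "\<And>m. (\<lambda>n. cinner (v (diagseq n)) (b m)) \<longlonglongrightarrow> a m" by metis
      then have "p \<longlonglongrightarrow> (\<Sum>m<N. (c m * a m) *\<^sub>C b m)"
        unfolding p_def by (intro tendsto_sum scaleC.tendsto tendsto_mult tendsto_const)
      then have "Cauchy p" by (rule LIMSEQ_imp_Cauchy)
      then obtain n0 where n0: "\<And>m n. m \<ge> n0 \<Longrightarrow> n \<ge> n0 \<Longrightarrow> norm (p m - p n) < \<epsilon> / 3"
        using \<open>\<epsilon> > 0\<close> unfolding Cauchy_iff by (meson divide_pos_pos zero_less_numeral)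
      have "dist (y m) (y n) < \<epsilon>" if "m \<ge> n0" "n \<ge> n0" for m n
      proof -
        have "y m - y n = (p m - p n) + (diag c' (v (diagseq m)) - diag c' (v (diagseq n)))"
          by (simp add: y_eq)
        then have "norm (y m - y n)
            \<le> norm (p m - p n) + (norm (diag c' (v (diagseq m))) + norm (diag c' (v (diagseq n))))"
          using order_trans[OF norm_triangle_ineq add_left_mono[OF norm_triangle_ineq4]] by simp
        then show ?thesis
          using n0[OF that] hi[of "diagseq m"] hi[of "diagseq n"] by (simp add: dist_norm)
      qed
      then show "\<exists>n0. \<forall>m\<ge>n0. \<forall>n\<ge>n0. dist (y m) (y n) < \<epsilon>" by blast
    qed
    then obtain l where "y \<longlonglongrightarrow> l" by (auto simp: Cauchy_convergent_iff convergent_def)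
    moreover have "y = (\<lambda>n. u (diagseq n))" by (simp add: y_def v(2) fun_eq_iff)
    ultimately show "\<exists>r l. strict_mono r \<and> (\<lambda>n. u (r n)) \<longlonglongrightarrow> l"
      using subseq_diagseq by blast
  qed
  then show ?thesis
    using diag_linear[OF C] by (simp add: compact_op_def)
qed

text \<open>Riesz representation in coordinates: the representing vector has coefficients
  \<open>cnj (a m)\<close>. They are square summable because testing \<open>A\<close> on the partial
  sum \<open>p\<close> gives \<open>cinner (A p) y = norm p ^ 2\<close>, hence
  \<open>norm p \<le> K * norm y\<close>.\<close>

lemma bounded_operator_has_adjoint:
  fixes A :: "'a \<Rightarrow> 'a"
  assumes "bounded_linear A" "linear_op UNIV A"
  shows "\<exists>z. \<forall>x. cinner (A x) y = cinner x z"
proof -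
  obtain K where K: "K > 0" "\<And>x. norm (A x) \<le> norm x * K"
    using bounded_linear.pos_bounded[OF assms(1)] by blast
  define a where "a m = cinner (A (b m)) y" for m
  have "(\<Sum>m<N. (cmod (cnj (a m)))\<^sup>2) \<le> (K * norm y)\<^sup>2" for N
  proof -
    define p where "p = (\<Sum>m<N. cnj (a m) *\<^sub>C b m)"
    have np: "(norm p)\<^sup>2 = (\<Sum>m<N. (cmod (cnj (a m)))\<^sup>2)"
      unfolding p_def by (rule norm_sum_b) simp
    have "cinner (A p) y = complex_of_real ((norm p)\<^sup>2)"
      unfolding np
      by (simp add: p_def linear_op_sum[OF assms(2)] linear_opD(3)[OF assms(2)] cinner.sum_left
          cinner_scaleC_left complex_norm_square mult.commute del: of_real_power flip: a_def)
    then have "(norm p)\<^sup>2 \<le> norm (A p) * norm y"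
      using norm_cinner_le[of "A p" y] by (simp add: norm_power)
    also have "\<dots> \<le> norm p * K * norm y" by (intro mult_right_mono K) simp
    finally have "norm p \<le> K * norm y"
      using K(1) by (cases "p = 0") (simp_all add: power2_eq_square mult.assoc)
    then have "(norm p)\<^sup>2 \<le> (K * norm y)\<^sup>2" by (simp add: power_mono)
    then show ?thesis by (simp add: np)
  qed
  from sums_b(1)[OF this] have z: "(\<lambda>m. cnj (a m) *\<^sub>C b m) sums (\<Sum>m. cnj (a m) *\<^sub>C b m)" (is "_ sums ?z")
    using K(1) by (intro summable_sums) simp
  have "cinner (A x) y = cinner x ?z" for x
  proof -
    have one: "\<And>m. cmod (1::complex) \<le> 1" by simp
    have "diag (\<lambda>_. 1) x = x" by (rule coef_eqI) (simp add: cinner_diag[OF one])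
    then have "(\<lambda>m. cinner x (b m) *\<^sub>C b m) sums x" using diag_sums[OF one, of x] by simp
    then have "(\<lambda>m. cinner (A (cinner x (b m) *\<^sub>C b m)) y) sums cinner (A x) y"
      by (intro bounded_linear.sums[OF cinner.bounded_linear_left] bounded_linear.sums[OF assms(1)])
    moreover have "cinner (A (cinner x (b m) *\<^sub>C b m)) y = cinner x (cnj (a m) *\<^sub>C b m)" for m
      by (simp add: linear_opD(3)[OF assms(2)] cinner_scaleC_left cinner_scaleC_right a_def)
    ultimately have "(\<lambda>m. cinner x (cnj (a m) *\<^sub>C b m)) sums cinner (A x) y" by simp
    moreover have "(\<lambda>m. cinner x (cnj (a m) *\<^sub>C b m)) sums cinner x ?z"
      by (rule bounded_linear.sums[OF cinner.bounded_linear_right z])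
    ultimately show ?thesis by (rule sums_unique2)
  qed
  then show ?thesis by blast
qed

end

locale diagonal_operator = orthonormal_sequence_basis b for b :: "nat \<Rightarrow> 'a::complex_hilbert_space" +
  fixes S :: "'a set" and D :: "'a \<Rightarrow> 'a" and \<nu> :: "nat \<Rightarrow> real"
  assumes D: "selfadjoint_op S D"
    and b_dom: "b n \<in> S"
    and D_b: "D (b n) = complex_of_real (\<nu> n) *\<^sub>C b n"
begin

lemma D_linear: "linear_op S D" and S_dense: "closure S = UNIV" and S_subspace: "csubspace S"
  using D by (auto simp: selfadjoint_op_def linear_op_def)

text \<open>Selfadjointness enters in this form: a vector satisfying the adjoint relation belongs to
  the domain, because the domain of the adjoint is \<open>S\<close>.\<close>

lemma adjointI:
  assumes "\<And>x. x \<in> S \<Longrightarrow> cinner (D x) y = cinner x z"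
  shows "y \<in> S" "D y = z"
proof -
  have "y \<in> adjoint_dom S D" using assms by (auto simp: adjoint_dom_def)
  then show y: "y \<in> S" using D by (simp add: selfadjoint_op_def)
  have "adjoint_op S D y = z" using assms by (intro adjoint_op_eqI[OF S_dense]) simp
  then show "D y = z" using y D by (simp add: selfadjoint_op_def)
qed

lemma D_coef:
  assumes "x \<in> S"
  shows "cinner (D x) (b m) = \<nu> m * cinner x (b m)"
proof -
  have "b m \<in> adjoint_dom S D" using b_dom D by (simp add: selfadjoint_op_def)
  then obtain z where z: "\<forall>x\<in>S. cinner (D x) (b m) = cinner x z" by (auto simp: adjoint_dom_def)
  then have "z = \<nu> m *\<^sub>C b m" using adjointI(2)[of "b m" z] D_b by simp
  then show ?thesis using z assms by (simp add: cinner_scaleC_right)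
qed

text \<open>Boundedness of \<open>c m\<close> and of \<open>\<nu> m * c m\<close> makes both series
  converge, and \<open>adjointI\<close> then places \<open>diag c h\<close> in the domain.\<close>

lemma diag_in_domain:
  fixes c :: "nat \<Rightarrow> complex"
  assumes c: "\<And>m. cmod (c m) \<le> C" and c': "\<And>m. cmod (\<nu> m * c m) \<le> C'"
  shows "diag c h \<in> S" "D (diag c h) = diag (\<lambda>m. \<nu> m * c m) h"
proof -
  have "cinner (D x) (diag c h) = cinner x (diag (\<lambda>m. \<nu> m * c m) h)" if "x \<in> S" for x
  proof -
    have "cnj (c m * cinner h (b m)) * cinner (D x) (b m)
        = cnj (\<nu> m * c m * cinner h (b m)) * cinner x (b m)" for m
      by (simp add: D_coef[OF that])
    then have "(\<lambda>m. cnj (\<nu> m * c m * cinner h (b m)) * cinner x (b m)) sums cinner (D x) (diag c h)"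
      using cinner_diag_right_sums[of c C h "D x", OF c] by (simp only:)
    moreover have "(\<lambda>m. cnj (\<nu> m * c m * cinner h (b m)) * cinner x (b m))
        sums cinner x (diag (\<lambda>m. \<nu> m * c m) h)"
      by (rule cinner_diag_right_sums[OF c'])
    ultimately show ?thesis by (rule sums_unique2)
  qed
  note adj = this
  show "diag c h \<in> S" by (rule adjointI(1)[OF adj])
  show "D (diag c h) = diag (\<lambda>m. \<nu> m * c m) h" by (rule adjointI(2)[OF adj])
qed

end

section \<open>Perturbation of an isolated eigenvalue\<close>

text \<open>The situation at one eigenvalue, with indices from 0. \<open>R_closable\<close> covers
  both alternatives for \<open>R\<close>: it lets \<open>R\<close> be applied term by term to a
  convergent series once the series of images converges. The bound \<open>1 / 4\<close> on
  \<open>\<Delta>\<close> yields the contraction factor \<open>1 / 2\<close> below. The denominators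
  in \<open>hilbert_schmidt_bound\<close> are the norms in the denominators of
  \<open>Delta_term\<close>.\<close>

locale isolated_level = diagonal_operator b S D \<nu>
  for b :: "nat \<Rightarrow> 'a::complex_hilbert_space" and S D \<nu> +
  fixes R :: "'a \<Rightarrow> 'a" and k :: nat and r \<Delta> :: real
  assumes R_linear: "linear_op S R"
    and R_closable: "\<lbrakk>\<And>n. u n \<in> S; u \<longlonglongrightarrow> x; x \<in> S; (\<lambda>n. R (u n)) \<longlonglongrightarrow> z\<rbrakk> \<Longrightarrow> R x = z"
    and \<nu>_lim: "filterlim \<nu> at_top sequentially"
    and r_pos: "r > 0"
    and r_le: "m \<noteq> k \<Longrightarrow> 2 * r \<le> \<bar>\<nu> m - \<nu> k\<bar>"
    and \<Delta>_nonneg: "\<Delta> \<ge> 0" and \<Delta>_le: "\<Delta> \<le> 1 / 4"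
    and hilbert_schmidt_bound:
      "(\<Sum>m<N. (norm (R (b m)) / (if m = k then r else \<bar>\<nu> m - \<nu> k\<bar> - r))\<^sup>2) \<le> \<Delta>\<^sup>2"
begin

text \<open>A lower bound for the distance of \<open>\<nu> m\<close> from the disc of radius \<open>r\<close> about \<open>\<nu> k\<close>, or from its
  boundary if \<open>m = k\<close>.\<close>

definition gap :: "nat \<Rightarrow> real" where
  "gap m = (if m = k then r else \<bar>\<nu> m - \<nu> k\<bar> - r)"

lemma hs: "(\<Sum>m<N. (norm (R (b m)) / gap m)\<^sup>2) \<le> \<Delta>\<^sup>2"
  unfolding gap_def by (rule hilbert_schmidt_bound)

lemma gap_ge: "r \<le> gap m"
  using r_le[of m] by (simp add: gap_def)

lemma gap_pos: "0 < gap m"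
  using gap_ge[of m] r_pos by simp

text \<open>By Cauchy-Schwarz for sums, the Hilbert-Schmidt bound and Bessel, the series of
  \<open>R (f m)\<close> converges absolutely with this bound; \<open>R_closable\<close> identifies
  its sum as \<open>R (diag c h)\<close>.\<close>

lemma norm_R_diag_le:
  assumes c: "\<And>m. cmod (c m) \<le> 1 / gap m" and dom: "diag c h \<in> S"
  shows "norm (R (diag c h)) \<le> \<Delta> * norm h"
proof -
  have c_le: "cmod (c m) \<le> 1 / r" for m
    using c[of m] gap_ge[of m] r_pos by (meson divide_left_mono gap_pos mult_pos_pos order_trans zero_le_one)
  define f where "f m = (c m * cinner h (b m)) *\<^sub>C b m" for m
  have f_dom: "f m \<in> S" for m
    unfolding f_def by (intro complex_vector.subspace_scale S_subspace b_dom)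
  have Rf: "R (f m) = (c m * cinner h (b m)) *\<^sub>C R (b m)" for m
    by (simp add: f_def linear_opD(3)[OF R_linear] b_dom)
  have sum_le: "(\<Sum>m<N. norm (R (f m))) \<le> \<Delta> * norm h" for N
  proof -
    have "(\<Sum>m<N. norm (R (f m)))
        \<le> (\<Sum>m<N. \<bar>norm (R (b m)) / gap m\<bar> * \<bar>cmod (cinner h (b m))\<bar>)"
    proof (rule sum_mono)
      fix m
      have "cmod (c m) * (cmod (cinner h (b m)) * norm (R (b m)))
          \<le> 1 / gap m * (cmod (cinner h (b m)) * norm (R (b m)))"
        by (intro mult_right_mono c) simp
      then show "norm (R (f m)) \<le> \<bar>norm (R (b m)) / gap m\<bar> * \<bar>cmod (cinner h (b m))\<bar>"
        using gap_pos[of m] by (simp add: Rf norm_mult mult_ac)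
    qed
    also have "\<dots> \<le> L2_set (\<lambda>m. norm (R (b m)) / gap m) {..<N} * L2_set (\<lambda>m. cmod (cinner h (b m))) {..<N}"
      by (rule L2_set_mult_ineq)
    also have "\<dots> \<le> \<Delta> * norm h"
      unfolding L2_set_def
      by (intro mult_mono real_le_lsqrt hs bessel \<Delta>_nonneg norm_ge_zero real_sqrt_ge_zero sum_nonneg zero_le_power2)
    finally show ?thesis .
  qed
  have sm: "summable (\<lambda>m. norm (R (f m)))"
    by (rule summableI_nonneg_bounded[OF norm_ge_zero sum_le])
  have "(\<lambda>N. \<Sum>m<N. R (f m)) \<longlonglongrightarrow> (\<Sum>m. R (f m))"
    by (rule summable_LIMSEQ[OF summable_norm_cancel[OF sm]])
  moreover have "(\<Sum>m<N. R (f m)) = R (\<Sum>m<N. f m)" for N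
    by (rule linear_op_sum[OF R_linear f_dom, symmetric])
  moreover have "(\<lambda>N. \<Sum>m<N. f m) \<longlonglongrightarrow> diag c h"
    using diag_sums[OF c_le] by (simp add: sums_def f_def)
  ultimately have "R (diag c h) = (\<Sum>m. R (f m))"
    by (intro R_closable[where u = "\<lambda>N. \<Sum>m<N. f m"] dom)
       (simp_all add: complex_vector.subspace_sum[OF S_subspace] f_dom)
  also have "norm \<dots> \<le> (\<Sum>m. norm (R (f m)))" by (rule summable_norm[OF sm])
  also have "\<dots> \<le> \<Delta> * norm h" by (rule suminf_le_const[OF sm sum_le])
  finally show ?thesis .
qed

text \<open>Only the term \<open>m = k\<close> of the Hilbert-Schmidt sum is kept, where
  \<open>gap k = r\<close>.\<close>

lemma norm_R_b_k: "norm (R (b k)) \<le> r * \<Delta>"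
proof -
  have "(norm (R (b k)) / gap k)\<^sup>2 \<le> (\<Sum>m<Suc k. (norm (R (b m)) / gap m)\<^sup>2)"
    by (rule member_le_sum) auto
  also have "\<dots> \<le> \<Delta>\<^sup>2" by (rule hs)
  finally have "norm (R (b k)) / r \<le> \<Delta>"
    using \<Delta>_nonneg by (auto simp: gap_def intro: power2_le_imp_le)
  then show ?thesis using r_pos by (simp add: field_simps)
qed

section \<open>The reduced resolvent of \<open>D\<close> near the level
  \<open>\<nu> k\<close>\<close>

definition reduced_coef :: "complex \<Rightarrow> nat \<Rightarrow> complex" where
  "reduced_coef z m = (if m = k then 0 else 1 / (complex_of_real (\<nu> m) - z))"

definition reduced_resolvent :: "complex \<Rightarrow> 'a \<Rightarrow> 'a" where
  "reduced_resolvent z = diag (reduced_coef z)"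

lemma gap_le_dist:
  fixes z :: complex
  assumes "cmod (z - \<nu> k) \<le> r" "m \<noteq> k"
  shows "gap m \<le> cmod (\<nu> m - z)"
proof -
  have "\<bar>\<nu> m - \<nu> k\<bar> = cmod ((\<nu> m - z) + (z - \<nu> k))"
    by (simp flip: of_real_diff)
  also have "\<dots> \<le> cmod (\<nu> m - z) + cmod (z - \<nu> k)" by (rule norm_triangle_ineq)
  finally show ?thesis using assms by (simp add: gap_def)
qed

context
  fixes z :: complex
  assumes z: "cmod (z - \<nu> k) \<le> r"
begin

lemma level_ne: "m \<noteq> k \<Longrightarrow> complex_of_real (\<nu> m) \<noteq> z"
  using gap_le_dist[OF z, of m] gap_pos[of m] by auto

lemma reduced_coef_gap: "cmod (reduced_coef z m) \<le> 1 / gap m"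
  using gap_le_dist[OF z, of m] gap_pos[of m]
  by (auto simp: reduced_coef_def norm_divide intro: frac_le)

lemma reduced_coef_le: "cmod (reduced_coef z m) \<le> 1 / r"
  using reduced_coef_gap[of m] frac_le[OF zero_le_one order_refl r_pos gap_ge[of m]] by simp

text \<open>Coefficient form of the fact that \<open>D - z\<close> times the reduced resolvent is
  the identity minus the projection onto \<open>b k\<close>.\<close>

lemma reduced_coef_D: "\<nu> m * reduced_coef z m = (if m = k then 0 else 1) + z * reduced_coef z m"
proof (cases "m = k")
  case False
  then have "\<nu> m - z \<noteq> 0" using level_ne[of m] by simp
  then have "(\<nu> m - z) * reduced_coef z m = 1" using False by (simp add: reduced_coef_def)
  then show ?thesis using False by (simp add: algebra_simps)
qed (simp add: reduced_coef_def)

lemma reduced_coef_D_le: "cmod (\<nu> m * reduced_coef z m) \<le> 1 + cmod z * (1 / r)"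
proof -
  have "cmod (\<nu> m * reduced_coef z m) \<le> cmod (if m = k then 0 else 1) + cmod (z * reduced_coef z m)"
    unfolding reduced_coef_D by (rule norm_triangle_ineq)
  also have "\<dots> \<le> 1 + cmod z * (1 / r)"
    unfolding norm_mult by (intro add_mono mult_left_mono reduced_coef_le) simp_all
  finally show ?thesis .
qed

lemma reduced_resolvent_dom: "reduced_resolvent z h \<in> S"
  unfolding reduced_resolvent_def by (rule diag_in_domain(1)[OF reduced_coef_le reduced_coef_D_le])

lemma reduced_resolvent_coef:
  "cinner (reduced_resolvent z h) (b m) = reduced_coef z m * cinner h (b m)"
  unfolding reduced_resolvent_def by (rule cinner_diag[OF reduced_coef_le])

lemma norm_reduced_resolvent_le: "norm (reduced_resolvent z h) \<le> norm h / r"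
  using norm_diag_le[of "reduced_coef z" "1 / r" h, OF reduced_coef_le] by (simp add: reduced_resolvent_def)

lemma norm_R_reduced_resolvent_le: "norm (R (reduced_resolvent z h)) \<le> \<Delta> * norm h"
  using norm_R_diag_le[OF reduced_coef_gap] reduced_resolvent_dom by (simp add: reduced_resolvent_def)

end

lemma reduced_resolvent_linear:
  fixes z :: complex
  assumes "cmod (z - \<nu> k) \<le> r"
  shows "linear_op UNIV (reduced_resolvent z)"
  unfolding reduced_resolvent_def by (rule diag_linear[OF reduced_coef_le[OF assms]])

text \<open>In the contraction estimate the reduced resolvent is taken at two candidate eigenvalues;
  this identity turns the difference into a factor \<open>z - w\<close>.\<close>

lemma reduced_resolvent_identity:
  fixes z w :: complex
  assumes z: "cmod (z - \<nu> k) \<le> r" and w: "cmod (w - \<nu> k) \<le> r"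
  shows "reduced_resolvent z h - reduced_resolvent w h
    = (z - w) *\<^sub>C reduced_resolvent z (reduced_resolvent w h)"
proof (rule coef_eqI)
  fix m
  have "1 / \<alpha> - 1 / \<beta> = (\<beta> - \<alpha>) * (1 / \<alpha> * (1 / \<beta>))" if "\<alpha> \<noteq> 0" "\<beta> \<noteq> 0" for \<alpha> \<beta> :: complex
    using that by (simp add: field_simps)
  from this[of "\<nu> m - z" "\<nu> m - w"]
  have "reduced_coef z m - reduced_coef w m = (z - w) * (reduced_coef z m * reduced_coef w m)"
    using level_ne[OF z, of m] level_ne[OF w, of m] by (simp add: reduced_coef_def)
  then show "cinner (reduced_resolvent z h - reduced_resolvent w h) (b m)
      = cinner ((z - w) *\<^sub>C reduced_resolvent z (reduced_resolvent w h)) (b m)"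
    by (simp add: cinner.diff_left cinner_scaleC_left reduced_resolvent_coef[OF z] reduced_resolvent_coef[OF w]
        flip: left_diff_distrib mult.assoc)
qed

text \<open>Eigenvalues of \<open>D + R\<close> near \<open>\<nu> k\<close> correspond to fixed points \<open>h\<close> of \<open>level_map\<close>: an eigenvector
  normalised to have \<open>k\<close>-th coefficient 1 is \<open>level_vector h\<close> with \<open>h = R x / r\<close>, and its eigenvalue
  is \<open>level_value h\<close>.\<close>

definition level_value :: "'a \<Rightarrow> complex" where
  "level_value h = \<nu> k + r * cinner h (b k)"

definition level_vector :: "'a \<Rightarrow> 'a" where
  "level_vector h = b k - complex_of_real r *\<^sub>C reduced_resolvent (level_value h) h"

definition level_map :: "'a \<Rightarrow> 'a" where
  "level_map h = complex_of_real (1 / r) *\<^sub>C R (level_vector h)"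

lemma level_value_dist: "cmod (level_value h - \<nu> k) \<le> r * norm h"
  using norm_cinner_le[of h "b k"] r_pos by (simp add: level_value_def norm_mult)

lemma level_value_near:
  assumes "norm h \<le> 1"
  shows "cmod (level_value h - \<nu> k) \<le> r"
  using level_value_dist[of h] mult_left_le[OF assms, of r] r_pos by linarith

lemma level_vector_dom:
  assumes "norm h \<le> 1"
  shows "level_vector h \<in> S"
  unfolding level_vector_def
  by (intro complex_vector.subspace_diff complex_vector.subspace_scale S_subspace b_dom
      reduced_resolvent_dom level_value_near assms)

lemma R_level_vector: "R (level_vector h) = complex_of_real r *\<^sub>C level_map h"
  using r_pos by (simp add: level_map_def)

lemma level_map_eq:
  assumes "cmod (level_value h - \<nu> k) \<le> r"
  shows "level_map h = complex_of_real (1 / r) *\<^sub>C R (b k) - R (reduced_resolvent (level_value h) h)"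
proof -
  note dom = reduced_resolvent_dom[OF assms]
  have "R (level_vector h)
      = R (b k) - complex_of_real r *\<^sub>C R (reduced_resolvent (level_value h) h)"
    unfolding level_vector_def
    by (simp add: linear_op_diff[OF R_linear] linear_opD(3)[OF R_linear] dom b_dom
        complex_vector.subspace_scale[OF S_subspace])
  then show ?thesis using r_pos by (simp add: level_map_def scaleC.diff_right)
qed

lemma norm_level_map_le:
  assumes "norm h \<le> 1"
  shows "norm (level_map h) \<le> \<Delta> + \<Delta> * norm h"
proof -
  have "norm (level_map h) \<le> norm (R (b k)) / r + norm (R (reduced_resolvent (level_value h) h))"
    using norm_triangle_ineq4[of "complex_of_real (1 / r) *\<^sub>C R (b k)"] r_pos
    by (simp add: level_map_eq[OF level_value_near[OF assms]] norm_divide)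
  moreover have "norm (R (b k)) / r \<le> \<Delta>" using norm_R_b_k r_pos by (simp add: field_simps)
  ultimately show ?thesis
    using norm_R_reduced_resolvent_le[OF level_value_near[OF assms], of h] by linarith
qed

text \<open>This smallness of the fixed point supplies the factor \<open>\<Delta>\<close> of the
  remainder.\<close>

lemma norm_fixed_point_le:
  assumes "norm h \<le> 1" "level_map h = h"
  shows "norm h \<le> 2 * \<Delta>"
  using norm_level_map_le[OF assms(1)] mult_left_mono[OF assms(1) \<Delta>_nonneg] assms(2) by simp

text \<open>Changing \<open>h\<close> acts in two ways, through the argument of the reduced
  resolvent and through the candidate eigenvalue. The resolvent identity controls the second, and
  each contributes at most \<open>\<Delta> * norm (g - h)\<close>.\<close>

lemma level_map_contraction:
  assumes "norm g \<le> 1" "norm h \<le> 1"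
  shows "norm (level_map g - level_map h) \<le> 1 / 2 * norm (g - h)"
proof -
  define z w where "z = level_value g" and "w = level_value h"
  have z: "cmod (z - \<nu> k) \<le> r" and w: "cmod (w - \<nu> k) \<le> r"
    using assms by (simp_all add: z_def w_def level_value_near)
  have "z - w = r * cinner (g - h) (b k)"
    by (simp add: z_def w_def level_value_def cinner.diff_left algebra_simps)
  then have zw: "cmod (z - w) \<le> r * norm (g - h)"
    using norm_cinner_le[of "g - h" "b k"] r_pos by (simp add: norm_mult)
  note dom = reduced_resolvent_dom[OF z] reduced_resolvent_dom[OF w]
  define u where "u = reduced_resolvent w h"
  have "reduced_resolvent z g - reduced_resolvent w h
      = reduced_resolvent z (g - h) + (reduced_resolvent z h - reduced_resolvent w h)"
    using linear_op_diff[OF reduced_resolvent_linear[OF z], of g h] by simp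
  also have "\<dots> = reduced_resolvent z (g - h) + (z - w) *\<^sub>C reduced_resolvent z u"
    unfolding reduced_resolvent_identity[OF z w] u_def ..
  finally have "R (reduced_resolvent z g) - R (reduced_resolvent w h)
      = R (reduced_resolvent z (g - h)) + (z - w) *\<^sub>C R (reduced_resolvent z u)"
    by (simp add: dom linear_opD[OF R_linear] complex_vector.subspace_scale[OF S_subspace]
        flip: linear_op_diff[OF R_linear])
  moreover have "level_map g - level_map h
      = - (R (reduced_resolvent z g) - R (reduced_resolvent w h))"
    by (simp add: level_map_eq level_value_near assms z_def w_def)
  ultimately have "norm (level_map g - level_map h)
      \<le> norm (R (reduced_resolvent z (g - h))) + cmod (z - w) * norm (R (reduced_resolvent z u))"
    by (metis norm_minus_cancel norm_scaleC norm_triangle_ineq)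
  also have "\<dots> \<le> \<Delta> * norm (g - h) + (r * norm (g - h)) * (\<Delta> * (1 / r))"
  proof (intro add_mono mult_mono zw norm_R_reduced_resolvent_le[OF z])
    have "norm u \<le> 1 / r"
      unfolding u_def using norm_reduced_resolvent_le[OF w, of h] assms(2) r_pos
      by (meson divide_right_mono less_imp_le order_trans)
    then show "norm (R (reduced_resolvent z u)) \<le> \<Delta> * (1 / r)"
      using norm_R_reduced_resolvent_le[OF z, of u] \<Delta>_nonneg by (meson mult_left_mono order_trans)
  qed (use r_pos in auto)
  also have "\<dots> = 2 * \<Delta> * norm (g - h)" using r_pos by simp
  also have "\<dots> \<le> 1 / 2 * norm (g - h)" using \<Delta>_le by (intro mult_right_mono) auto
  finally show ?thesis .
qed

lemma ex1_fixed_point: "\<exists>!h. h \<in> cball 0 1 \<and> level_map h = h"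
proof (rule Banach_fix[of "cball 0 1" "1 / 2"])
  show "complete (cball (0::'a) 1)" by (simp add: complete_eq_closed)
  show "level_map ` cball 0 1 \<subseteq> cball 0 1"
  proof clarsimp
    fix h :: 'a assume h: "norm h \<le> 1"
    have "\<Delta> * norm h \<le> \<Delta>" using mult_left_mono[OF h \<Delta>_nonneg] by simp
    then show "norm (level_map h) \<le> 1"
      using norm_level_map_le[OF h] \<Delta>_le by linarith
  qed
  show "dist (level_map g) (level_map h) \<le> 1 / 2 * dist g h" if "g \<in> cball 0 1" "h \<in> cball 0 1" for g h
    using level_map_contraction[of g h] that by (simp add: dist_norm)
qed auto

section \<open>Eigenvalues in the disc and fixed points of \<open>level_map\<close>\<close>

lemma fixed_point_imp_eigenvalue:
  assumes h: "norm h \<le> 1" "level_map h = h"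
  shows "eigenvalue_op S (\<lambda>x. D x + R x) (level_value h)" "cmod (level_value h - \<nu> k) < r"
proof -
  define z where "z = level_value h"
  have z: "cmod (z - \<nu> k) \<le> r" unfolding z_def by (rule level_value_near[OF h(1)])
  define x where "x = level_vector h"
  have x_dom: "x \<in> S" unfolding x_def by (rule level_vector_dom[OF h(1)])
  have x_eq: "x = b k - complex_of_real r *\<^sub>C reduced_resolvent z h"
    by (simp add: x_def level_vector_def z_def)
  have x_coef: "cinner x (b m) = (if m = k then 1 else 0) - r * (reduced_coef z m * cinner h (b m))" for m
    by (simp add: x_eq cinner.diff_left cinner_scaleC_left reduced_resolvent_coef[OF z] cinner_b)
  have Rx: "R x = complex_of_real r *\<^sub>C h"
    unfolding x_def R_level_vector h(2) ..
  have "D x + R x = z *\<^sub>C x"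
  proof (rule coef_eqI)
    fix m
    have "cinner (D x + R x) (b m)
        = \<nu> m * (if m = k then 1 else 0) - r * (\<nu> m * reduced_coef z m) * cinner h (b m) + r * cinner h (b m)"
      by (simp add: cinner_add_left D_coef[OF x_dom] x_coef Rx cinner_scaleC_left algebra_simps)
    \<comment> \<open>For \<open>m \<noteq> k\<close> the terms \<open>r * cinner h (b m)\<close>
      cancel by \<open>reduced_coef_D\<close>; for \<open>m = k\<close> the equation is the
      definition of \<open>level_value\<close>.\<close>
    also have "\<dots> = z * ((if m = k then 1 else 0) - r * (reduced_coef z m * cinner h (b m)))"
      unfolding reduced_coef_D[OF z]
      by (auto simp: z_def level_value_def reduced_coef_def algebra_simps)
    finally show "cinner (D x + R x) (b m) = cinner (z *\<^sub>C x) (b m)"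
      by (simp add: cinner_scaleC_left x_coef)
  qed
  moreover have "x \<noteq> 0" using x_coef[of k] by (auto simp: reduced_coef_def cinner.zero_left)
  ultimately show "eigenvalue_op S (\<lambda>x. D x + R x) (level_value h)"
    using x_dom by (auto simp: eigenvalue_op_def z_def)
  \<comment> \<open>The bound \<open>2 * \<Delta> \<le> 1 / 2\<close> places the eigenvalue strictly
    inside the circle.\<close>
  have "norm h < 1" using norm_fixed_point_le[OF h] \<Delta>_le by simp
  then have "r * norm h < r" using r_pos by simp
  then show "cmod (level_value h - \<nu> k) < r" using level_value_dist[of h] by linarith
qed

lemma eigenvalue_imp_fixed_point:
  fixes z :: complex
  assumes "eigenvalue_op S (\<lambda>x. D x + R x) z" "cmod (z - \<nu> k) < r"
  shows "\<exists>h. norm h \<le> 1 \<and> level_map h = h \<and> level_value h = z"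
proof -
  have z: "cmod (z - \<nu> k) \<le> r" using assms(2) by simp
  obtain x where x: "x \<in> S" "x \<noteq> 0" "D x + R x = z *\<^sub>C x"
    using assms(1) by (auto simp: eigenvalue_op_def)
  have coef: "\<nu> m * cinner x (b m) + cinner (R x) (b m) = z * cinner x (b m)" for m
    using arg_cong[OF x(3), of "\<lambda>y. cinner y (b m)"]
    by (simp add: cinner_add_left cinner_scaleC_left D_coef[OF x(1)])
  define a where "a = cinner x (b k)"
  have x_eq: "x = a *\<^sub>C b k - reduced_resolvent z (R x)"
  proof (rule coef_eqI)
    fix m
    show "cinner x (b m) = cinner (a *\<^sub>C b k - reduced_resolvent z (R x)) (b m)"
    proof (cases "m = k")
      case False
      have "cinner (R x) (b m) = - ((\<nu> m - z) * cinner x (b m))"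
        using coef[of m] by (simp add: algebra_simps add_eq_0_iff)
      then show ?thesis
        using False level_ne[OF z, of m]
        by (simp add: cinner.diff_left cinner_scaleC_left reduced_resolvent_coef[OF z] cinner_b reduced_coef_def)
    qed (simp add: cinner.diff_left cinner_scaleC_left reduced_resolvent_coef[OF z] cinner_b reduced_coef_def a_def)
  qed
  note dom = reduced_resolvent_dom[OF z]
  \<comment> \<open>If \<open>a = 0\<close>, applying \<open>R\<close> to \<open>x_eq\<close> gives
    \<open>norm (R x) \<le> \<Delta> * norm (R x)\<close>; hence \<open>R x = 0\<close>, and then
    \<open>x = 0\<close>.\<close>
  have "a \<noteq> 0"
  proof
    assume "a = 0"
    then have x0: "x = - reduced_resolvent z (R x)" using x_eq by simp
    then have "R x = - R (reduced_resolvent z (R x))"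
      using linear_op_diff[OF R_linear complex_vector.subspace_0[OF S_subspace] dom] linear_op_zero[OF R_linear]
      by (metis diff_0)
    then have "norm (R x) \<le> \<Delta> * norm (R x)"
      using norm_R_reduced_resolvent_le[OF z] by (metis norm_minus_cancel)
    also have "\<dots> \<le> 1 / 4 * norm (R x)" using \<Delta>_le by (rule mult_right_mono) simp
    finally have "R x = 0" by simp
    then show False using x0 x(2) linear_op_zero[OF reduced_resolvent_linear[OF z]] by simp
  qed
  \<comment> \<open>Dividing by \<open>a\<close> normalises the eigenvector to have
    \<open>k\<close>-th coefficient 1.\<close>
  define h where "h = (1 / (a * r)) *\<^sub>C R x"
  have Rx: "R x = (a * r) *\<^sub>C h" using \<open>a \<noteq> 0\<close> r_pos by (simp add: h_def)
  have "z * a = \<nu> k * a + cinner (R x) (b k)" using coef[of k] by (simp add: a_def)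
  also have "\<dots> = (\<nu> k + r * cinner h (b k)) * a" by (simp add: Rx cinner_scaleC_left algebra_simps)
  finally have val: "level_value h = z" using \<open>a \<noteq> 0\<close> by (simp add: level_value_def)
  have "reduced_resolvent z (R x) = a *\<^sub>C complex_of_real r *\<^sub>C reduced_resolvent z h"
    unfolding Rx by (simp add: linear_opD(3)[OF reduced_resolvent_linear[OF z]])
  then have x_level: "x = a *\<^sub>C level_vector h"
    using x_eq by (simp add: level_vector_def val scaleC.diff_right)
  then have "level_vector h = (1 / a) *\<^sub>C x" using \<open>a \<noteq> 0\<close> by simp
  then have fixed: "level_map h = h"
    by (simp add: level_map_def linear_opD(3)[OF R_linear x(1)] h_def mult.commute)
  \<comment> \<open>The bound \<open>norm h \<le> 1\<close> is not yet known. It comes from the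
    fixed point equation at \<open>z\<close>, which lies in the disc by assumption, so that the
    reduced resolvent estimate applies.\<close>
  have h_eq: "h = complex_of_real (1 / r) *\<^sub>C R (b k) - R (reduced_resolvent z h)"
    using level_map_eq[of h] z unfolding val fixed by blast
  have "norm h \<le> norm (complex_of_real (1 / r) *\<^sub>C R (b k)) + norm (R (reduced_resolvent z h))"
    by (rule ord_eq_le_trans[OF arg_cong[OF h_eq, of norm] norm_triangle_ineq4])
  moreover have "norm (complex_of_real (1 / r) *\<^sub>C R (b k)) \<le> \<Delta>"
    using norm_R_b_k r_pos by (simp add: norm_divide field_simps)
  moreover have "\<Delta> * norm h \<le> 1 / 4 * norm h" using \<Delta>_le by (rule mult_right_mono) simp
  ultimately have "norm h \<le> 1"
    using norm_R_reduced_resolvent_le[OF z, of h] \<Delta>_le by linarith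
  then show ?thesis using fixed val by blast
qed

theorem ex1_eigenvalue:
  "\<exists>!z. eigenvalue_op S (\<lambda>x. D x + R x) z \<and> cmod (z - \<nu> k) < r"
proof -
  obtain h where h: "norm h \<le> 1 \<and> level_map h = h"
    and unique: "\<forall>g. norm g \<le> 1 \<and> level_map g = g \<longrightarrow> g = h"
    using ex1_fixed_point unfolding mem_cball_0 by (rule ex1E) (rule that)
  show ?thesis
  proof (rule ex1I)
    show "eigenvalue_op S (\<lambda>x. D x + R x) (level_value h) \<and> cmod (level_value h - \<nu> k) < r"
      using fixed_point_imp_eigenvalue h by blast
    show "w = level_value h" if "eigenvalue_op S (\<lambda>x. D x + R x) w \<and> cmod (w - \<nu> k) < r" for w
      using eigenvalue_imp_fixed_point[of w] that unique by blast
  qed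
qed

text \<open>Inserting the fixed point equation into \<open>z - \<nu> k = r * cinner h (b k)\<close>
  leaves, up to sign, the remainder \<open>r * cinner (reduced_resolvent z h) s\<close>. The factor
  \<open>r\<close> cancels against the bound \<open>norm h / r\<close>, and
  \<open>norm h \<le> 2 * \<Delta>\<close> gives the constant.\<close>

theorem eigenvalue_estimate:
  fixes z :: complex
  assumes "eigenvalue_op S (\<lambda>x. D x + R x) z" "cmod (z - \<nu> k) < r"
    and adj: "\<And>x. x \<in> S \<Longrightarrow> cinner (R x) (b k) = cinner x s"
  shows "cmod (z - (\<nu> k + cinner (R (b k)) (b k))) \<le> 2 * (\<Delta> * norm s)"
proof -
  obtain h where h: "norm h \<le> 1" "level_map h = h" "level_value h = z"
    using eigenvalue_imp_fixed_point[OF assms(1,2)] by blast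
  have z: "cmod (z - \<nu> k) \<le> r" using assms(2) by simp
  have h_eq: "h = complex_of_real (1 / r) *\<^sub>C R (b k) - R (reduced_resolvent z h)"
    using level_map_eq[OF level_value_near[OF h(1)]] unfolding h(2,3) .
  have val: "z - \<nu> k = r * cinner h (b k)" unfolding h(3)[symmetric] by (simp add: level_value_def)
  have rh: "r * cinner h (b k) = cinner (R (b k)) (b k) - r * cinner (reduced_resolvent z h) s"
    by (subst h_eq) (use r_pos in \<open>simp add: cinner.diff_left cinner_scaleC_left adj[OF reduced_resolvent_dom[OF z]] right_diff_distrib\<close>)
  have "z - (\<nu> k + cinner (R (b k)) (b k)) = - (r * cinner (reduced_resolvent z h) s)"
    unfolding diff_diff_eq[symmetric] val rh by simp
  then have "cmod (z - (\<nu> k + cinner (R (b k)) (b k))) = r * cmod (cinner (reduced_resolvent z h) s)"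
    using r_pos by (simp add: norm_mult)
  also have "\<dots> \<le> r * (norm h / r * norm s)"
    using norm_cinner_le[of "reduced_resolvent z h" s]
      mult_right_mono[OF norm_reduced_resolvent_le[OF z, of h] norm_ge_zero[of s]] r_pos
    by (intro mult_left_mono) linarith+
  also have "\<dots> = norm h * norm s" using r_pos by simp
  also have "\<dots> \<le> 2 * \<Delta> * norm s" by (intro mult_right_mono norm_fixed_point_le h norm_ge_zero)
  finally show ?thesis by simp
qed

end

section \<open>Discreteness of the spectrum of \<open>D + R\<close>\<close>

lemma compact_op_compose:
  assumes J: "compact_op J" and L: "linear_op UNIV L" and bound: "\<And>x. norm (L x) \<le> M * norm x"
  shows "compact_op (\<lambda>x. J (L x))"
  unfolding compact_op_def
proof (intro conjI allI impI)
  have "linear_op UNIV J" using J by (simp add: compact_op_def)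
  then show "linear_op UNIV (\<lambda>x. J (L x))"
    using L by (auto simp: linear_op_def)
  fix B :: "'a set"
  assume "bounded B"
  then obtain C where C: "\<And>x. x \<in> B \<Longrightarrow> norm x \<le> C" by (auto simp: bounded_iff)
  have "norm (L x) \<le> \<bar>M\<bar> * \<bar>C\<bar>" if "x \<in> B" for x
    using bound[of x] C[OF that] by (meson abs_ge_self abs_ge_zero mult_mono norm_ge_zero order_trans)
  then have "bounded (L ` B)" by (auto simp: bounded_iff)
  then have "compact (closure (J ` L ` B))" using J by (simp add: compact_op_def)
  then show "compact (closure ((\<lambda>x. J (L x)) ` B))" by (simp add: image_image)
qed

text \<open>\<open>L f\<close> is the fixed point of the contraction that sends \<open>g\<close> to
  \<open>f - A g\<close>. Uniqueness gives linearity, and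
  \<open>norm (L f) \<le> norm f + norm (L f) / 2\<close> gives the bound 2.\<close>

lemma small_perturbation_of_identity_inverse:
  assumes A: "linear_op UNIV A" and small: "\<And>x. norm (A x) \<le> 1 / 2 * norm x"
  obtains L where "\<And>f. L f + A (L f) = f" "\<And>g. L (g + A g) = g" "linear_op UNIV L"
    "\<And>f. norm (L f) \<le> 2 * norm f"
proof -
  have "dist (f - A x) (f - A y) \<le> 1 / 2 * dist x y" for f x y
    using small[of "x - y"] by (simp add: dist_norm linear_op_diff[OF A] norm_minus_commute)
  then have "\<exists>!g. f - A g = g" for f
    by (intro banach_fix_type[of "1 / 2"]) simp_all
  moreover have "f - A g = g \<longleftrightarrow> g + A g = f" for f g
    by (auto simp: algebra_simps)
  ultimately have ex1: "\<exists>!g. g + A g = f" for f by simp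
  then obtain L where L: "\<And>f. L f + A (L f) = f" by metis
  have eqI: "L f = g" if "g + A g = f" for f g using ex1[of f] L that by blast
  have "linear_op UNIV L"
    unfolding linear_op_def
  proof (intro conjI ballI allI)
    show "L (x + y) = L x + L y" for x y
      by (rule eqI) (use L[of x] L[of y] in \<open>simp add: linear_opD(2)[OF A] algebra_simps\<close>)
    show "L (c *\<^sub>C x) = c *\<^sub>C L x" for c x
      by (rule eqI) (simp add: linear_opD(3)[OF A] L flip: scaleC_add_right)
  qed simp
  moreover have "norm (L f) \<le> 2 * norm f" for f
    using norm_triangle_ineq2[of "L f" "- A (L f)"] L[of f] small[of "L f"] by simp
  ultimately show thesis using that L eqI by blast
qed

context isolated_level
begin

text \<open>The point \<open>\<nu> k + r\<close> is in the resolvent set: there \<open>R\<close> times the resolvent of \<open>D\<close> has norm at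
  most \<open>\<Delta>\<close>.\<close>

theorem discrete_spectrum_perturbed: "discrete_spectrum S (\<lambda>x. D x + R x)"
proof -
  define z0 where "z0 = \<nu> k + r"
  define c where "c m = complex_of_real (1 / (\<nu> m - z0))" for m
  have dist: "gap m \<le> \<bar>\<nu> m - z0\<bar>" for m
    using r_pos by (auto simp: gap_def z0_def)
  have c_gap: "cmod (c m) \<le> 1 / gap m" for m
    using frac_le[OF zero_le_one order_refl gap_pos dist[of m]] by (simp add: c_def norm_divide flip: of_real_diff)
  have c_le: "cmod (c m) \<le> 1 / r" for m
    using c_gap[of m] frac_le[OF zero_le_one order_refl r_pos gap_ge[of m]] by simp
  have \<nu>_c: "\<nu> m * c m = 1 + z0 * c m" for m
  proof -
    have "(\<nu> m - z0) * (1 / (\<nu> m - z0)) = 1" using dist[of m] gap_pos[of m] by simp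
    then have "\<nu> m * (1 / (\<nu> m - z0)) = 1 + z0 * (1 / (\<nu> m - z0))" by (simp only: left_diff_distrib)
    then show ?thesis unfolding c_def by (metis of_real_1 of_real_add of_real_mult)
  qed
  have \<nu>_c_le: "cmod (\<nu> m * c m) \<le> 1 + \<bar>z0\<bar> * (1 / r)" for m
  proof -
    have "cmod (\<nu> m * c m) \<le> 1 + cmod (z0 * c m)"
      unfolding \<nu>_c using norm_triangle_ineq[of 1 "z0 * c m"] by simp
    also have "\<dots> \<le> 1 + \<bar>z0\<bar> * (1 / r)"
      unfolding norm_mult norm_of_real by (intro add_left_mono mult_left_mono c_le) simp
    finally show ?thesis .
  qed
  define J where "J = diag c"
  have J_coef: "cinner (J h) (b m) = c m * cinner h (b m)" for h m
    unfolding J_def by (rule cinner_diag[OF c_le])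
  have J_dom: "J h \<in> S" and D_J: "D (J h) = diag (\<lambda>m. \<nu> m * c m) h" for h
    unfolding J_def by (rule diag_in_domain[OF c_le \<nu>_c_le])+
  have D_J_coef: "cinner (D (J h)) (b m) = \<nu> m * c m * cinner h (b m)" for h m
    unfolding D_J by (rule cinner_diag[of "\<lambda>m. \<nu> m * c m", OF \<nu>_c_le])
  have D_J_shift: "D (J h) - z0 *\<^sub>C J h = h" for h
  proof (rule coef_eqI)
    fix m
    have "cinner (D (J h) - z0 *\<^sub>C J h) (b m) = (\<nu> m * c m - z0 * c m) * cinner h (b m)"
      by (simp add: cinner.diff_left cinner_scaleC_left J_coef D_J_coef algebra_simps)
    then show "cinner (D (J h) - z0 *\<^sub>C J h) (b m) = cinner h (b m)" by (simp add: \<nu>_c)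
  qed
  have J_D_shift: "J (D x - z0 *\<^sub>C x) = x" if "x \<in> S" for x
  proof (rule coef_eqI)
    fix m
    have "cinner (J (D x - z0 *\<^sub>C x)) (b m) = (\<nu> m * c m - z0 * c m) * cinner x (b m)"
      by (simp add: J_coef cinner.diff_left cinner_scaleC_left D_coef[OF that] algebra_simps)
    then show "cinner (J (D x - z0 *\<^sub>C x)) (b m) = cinner x (b m)" by (simp add: \<nu>_c)
  qed
  \<comment> \<open>Because \<open>\<nu>\<close> tends to infinity, the eigenvalues
    \<open>c m\<close> of \<open>J\<close> tend to 0 and \<open>J\<close> is compact.\<close>
  have "filterlim (\<lambda>m. - z0 + \<nu> m) at_top sequentially"
    by (rule filterlim_tendsto_add_at_top[OF tendsto_const \<nu>_lim])
  from tendsto_inverse_0_at_top[OF this] have "(\<lambda>m. complex_of_real (inverse (- z0 + \<nu> m))) \<longlonglongrightarrow> of_real 0"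
    by (rule tendsto_of_real)
  then have "c \<longlonglongrightarrow> 0" by (simp add: c_def[abs_def] divide_inverse add.commute)
  then have J_compact: "compact_op J" unfolding J_def by (rule compact_op_diag)
  then have J_lin: "linear_op UNIV J" by (simp add: compact_op_def)
  have RJ_lin: "linear_op UNIV (\<lambda>h. R (J h))"
    using J_lin R_linear J_dom by (auto simp: linear_op_def)
  have "norm (R (J h)) \<le> 1 / 2 * norm h" for h
  proof -
    have "norm (R (J h)) \<le> \<Delta> * norm h"
      unfolding J_def by (rule norm_R_diag_le[OF c_gap]) (use J_dom in \<open>simp add: J_def\<close>)
    also have "\<dots> \<le> 1 / 2 * norm h" using \<Delta>_le by (intro mult_right_mono) auto
    finally show ?thesis .
  qed
  then obtain L where L: "\<And>f. L f + R (J (L f)) = f" "\<And>g. L (g + R (J g)) = g"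
    "linear_op UNIV L" "\<And>f. norm (L f) \<le> 2 * norm f"
    using small_perturbation_of_identity_inverse[OF RJ_lin] by blast
  \<comment> \<open>\<open>J\<close> inverts \<open>D - z0\<close>, so
    \<open>(D + R - z0) J = 1 + R J\<close>; with \<open>L\<close> inverse to
    \<open>1 + R J\<close>, the resolvent of \<open>D + R\<close> at \<open>z0\<close> is
    \<open>J L\<close>.\<close>
  interpret compact_inverse S "\<lambda>x. D x + R x" "\<lambda>f. J (L f)" z0
  proof
    show "linear_op S (\<lambda>x. D x + R x)"
      using D_linear R_linear by (auto simp: linear_op_def scaleC_add_right)
    show "compact_op (\<lambda>f. J (L f))" by (rule compact_op_compose[OF J_compact L(3,4)])
    show "J (L f) \<in> S" for f by (rule J_dom)
    show "D (J (L f)) + R (J (L f)) - z0 *\<^sub>C J (L f) = f" for f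
      using D_J_shift[of "L f"] L(1)[of f] by (simp add: algebra_simps)
    show "J (L (D x + R x - z0 *\<^sub>C x)) = x" if "x \<in> S" for x
    proof -
      have "D x + R x - z0 *\<^sub>C x = (D x - z0 *\<^sub>C x) + R (J (D x - z0 *\<^sub>C x))"
        by (simp add: J_D_shift[OF that])
      then show ?thesis using L(2) J_D_shift[OF that] by metis
    qed
  qed
  show ?thesis by (rule discrete_spectrum)
qed

end

section \<open>From the hypotheses of the theorem to an isolated level\<close>

lemma symmetric_op_closable:
  assumes A: "symmetric_op S A"
    and "\<And>n. u n \<in> S" "u \<longlonglongrightarrow> x" "x \<in> S" "(\<lambda>n. A (u n)) \<longlonglongrightarrow> z"
  shows "A x = z"
proof (rule cinner_dense_eqI[of S])
  show "closure S = UNIV" using A by (simp add: symmetric_op_def)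
  fix y assume "y \<in> S"
  have sym: "cinner (A v) w = cinner v (A w)" if "v \<in> S" "w \<in> S" for v w
    using A that by (simp add: symmetric_op_def)
  \<comment> \<open>Symmetry moves \<open>A\<close> onto the fixed vector \<open>y\<close>, so both
    limits belong to the same sequence of numbers.\<close>
  have "(\<lambda>n. cinner (A y) (u n)) \<longlonglongrightarrow> cinner (A y) x"
    by (intro cinner.tendsto tendsto_const assms(3))
  moreover have "(\<lambda>n. cinner y (A (u n))) \<longlonglongrightarrow> cinner y z"
    by (intro cinner.tendsto tendsto_const assms(5))
  ultimately show "cinner y (A x) = cinner y z"
    using LIMSEQ_unique by (simp add: sym \<open>y \<in> S\<close> assms(2,4))
qed

lemma linear_op_subset: "linear_op S A \<Longrightarrow> S' \<subseteq> S \<Longrightarrow> csubspace S' \<Longrightarrow> linear_op S' A"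
  unfolding linear_op_def by blast

lemma half_gap_pos:
  assumes "strict_mono_on {1..} \<mu>" "n \<ge> 2"
  shows "half_gap \<mu> n > 0"
  using strict_mono_onD[OF assms(1), of "n - 1" n] strict_mono_onD[OF assms(1), of n "n + 1"] assms(2)
  by (simp add: half_gap_def)

lemma half_gap_le:
  assumes \<mu>: "strict_mono_on {1..} \<mu>" and "n \<ge> 2" "m \<ge> 1" "m \<noteq> n"
  shows "2 * half_gap \<mu> n \<le> \<bar>\<mu> m - \<mu> n\<bar>"
proof -
  have mono: "\<mu> i \<le> \<mu> j" if "1 \<le> i" "i \<le> j" for i j
    using strict_mono_onD[OF \<mu>, of i j] that by (cases "i = j") auto
  have "2 * half_gap \<mu> n \<le> \<mu> n - \<mu> (n - 1)" "2 * half_gap \<mu> n \<le> \<mu> (n + 1) - \<mu> n"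
    by (simp_all add: half_gap_def)
  moreover have "m \<le> n - 1 \<or> n + 1 \<le> m" using assms(4) by arith
  ultimately show ?thesis
    using mono[of m "n - 1"] mono[of "n + 1" m] assms(2,3) by (elim disjE) simp_all
qed

text \<open>Subtracting \<open>half_gap \<mu> n\<close> times \<open>sign_op e n\<close> moves every
  \<open>\<mu> m\<close> with \<open>m \<noteq> n\<close> by the half gap toward
  \<open>\<mu> n\<close>, and moves \<open>\<mu> n\<close> itself away by the half gap. The
  resulting distances are the denominators of \<open>isolated_level\<close>.\<close>

lemma Delta_term_eq:
  fixes e :: "nat \<Rightarrow> 'a::complex_hilbert_space"
  assumes basis: "orthonormal_basis e {1..}" and \<mu>: "strict_mono_on {1..} \<mu>"
    and De: "D (e m) = complex_of_real (\<mu> m) *\<^sub>C e m" and "n \<ge> 2" "m \<ge> 1"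
  shows "Delta_term D R \<mu> e n m =
    (norm (R (e m)) / (if m = n then half_gap \<mu> n else \<bar>\<mu> m - \<mu> n\<bar> - half_gap \<mu> n))\<^sup>2"
proof -
  define r where "r = half_gap \<mu> n"
  define t where "t = (if m > n then \<mu> m - \<mu> n - r else \<mu> m - \<mu> n + r)"
  have "cinner (e m) (e m) = 1" using basis \<open>m \<ge> 1\<close> by (simp add: orthonormal_basis_def)
  then have "norm (e m) = 1"
    by (metis Re_cinner norm_eq_1 one_complex.sel(1))
  have "D (e m) - of_real (\<mu> n) *\<^sub>C e m - of_real r *\<^sub>C sign_op e n (e m) = complex_of_real t *\<^sub>C e m"
    unfolding sign_op_basis[OF basis \<open>m \<ge> 1\<close>] De
    by (auto simp: t_def scaleC_of_real scaleR_diff_left scaleR_add_left)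
  then have "norm (D (e m) - of_real (\<mu> n) *\<^sub>C e m - of_real r *\<^sub>C sign_op e n (e m)) = \<bar>t\<bar>"
    using \<open>norm (e m) = 1\<close> by simp
  moreover have "\<bar>t\<bar> = (if m = n then r else \<bar>\<mu> m - \<mu> n\<bar> - r)"
  proof -
    have "0 < r" using half_gap_pos[OF \<mu> \<open>n \<ge> 2\<close>] by (simp add: r_def)
    moreover have "2 * r \<le> \<bar>\<mu> m - \<mu> n\<bar>" if "m \<noteq> n"
      using half_gap_le[OF \<mu> \<open>n \<ge> 2\<close> \<open>m \<ge> 1\<close> that] by (simp add: r_def)
    moreover have "\<mu> n < \<mu> m" if "m > n" using strict_mono_onD[OF \<mu>, of n m] that assms(4) by simp
    moreover have "\<mu> m < \<mu> n" if "m < n" using strict_mono_onD[OF \<mu>, of m n] that assms(5) by simp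
    ultimately show ?thesis by (cases m n rule: linorder_cases) (auto simp: t_def)
  qed
  ultimately show ?thesis by (simp add: Delta_term_def r_def power_divide)
qed

theorem theorem3p1:
  fixes D R :: "'a::complex_hilbert_space \<Rightarrow> 'a"
    and domD domR :: "'a set"
    and e :: "nat \<Rightarrow> 'a"
    and \<mu> :: "nat \<Rightarrow> real"
  assumes D: "selfadjoint_op domD D"
    and basis: "orthonormal_basis e {1..}"
    and eigen: "\<forall>n\<ge>1. e n \<in> domD \<and> D (e n) = complex_of_real (\<mu> n) *\<^sub>C e n"
    and mu_mono: "strict_mono_on {1..} \<mu>"
    and mu_lim: "filterlim \<mu> at_top sequentially"
    and R: "symmetric_op domR R \<and> relatively_compact_op domD D domR R \<or>
            domR = UNIV \<and> compact_op R"
    and Delta_exists: "\<forall>n\<ge>2. Delta_term D R \<mu> e n summable_on {1..}"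
    and Delta_lim: "Delta D R \<mu> e \<longlonglongrightarrow> 0"
  shows "discrete_spectrum domD (\<lambda>x. D x + R x) \<and>
    (\<forall>\<^sub>F n in sequentially. \<exists>!z. eigenvalue_op domD (\<lambda>x. D x + R x) z \<and>
        cmod (z - complex_of_real (\<mu> n)) < half_gap \<mu> n) \<and>
    (\<forall>ev :: nat \<Rightarrow> complex.
       (\<forall>\<^sub>F n in sequentially. eigenvalue_op domD (\<lambda>x. D x + R x) (ev n) \<and>
          cmod (ev n - complex_of_real (\<mu> n)) < half_gap \<mu> n) \<longrightarrow>
       (\<lambda>n. ev n - (complex_of_real (\<mu> n) + cinner (R (e n)) (e n)))
         \<in> O(\<lambda>n. complex_of_real (Delta D R \<mu> e n * norm (adjoint_op domR R (e n)))))"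
proof -
  \<comment> \<open>The locales index the basis from 0, so level \<open>k\<close> there is
    \<open>n = Suc k\<close> here.\<close>
  define b where "b m = e (Suc m)" for m
  define \<nu> where "\<nu> m = \<mu> (Suc m)" for m
  have "e ` {1..} = range b"
    by (auto simp: b_def image_iff dest!: Suc_le_D)
  interpret diagonal_operator b domD D \<nu>
  proof
    show "cinner (b m) (b n) = (if m = n then 1 else 0)" for m n
      using basis by (simp add: orthonormal_basis_def b_def)
    show "closure (cspan (range b)) = UNIV"
      using basis \<open>e ` {1..} = range b\<close> by (simp add: orthonormal_basis_def)
    show "b n \<in> domD" "D (b n) = complex_of_real (\<nu> n) *\<^sub>C b n" for n
      using eigen by (simp_all add: b_def \<nu>_def)
  qed (rule D)
  \<comment> \<open>Both alternatives for \<open>R\<close> give the same facts: linearity,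
    closability, and the adjoint relation for \<open>y\<close> in the domain of \<open>D\<close>.
    For symmetric \<open>R\<close> the adjoint agrees with \<open>R\<close> there; for compact
    \<open>R\<close> it exists by boundedness.\<close>
  have R_props: "domD \<subseteq> domR \<and> linear_op domR R \<and>
      (\<forall>u x z. (\<forall>n. u n \<in> domR) \<longrightarrow> u \<longlonglongrightarrow> x \<longrightarrow> x \<in> domR \<longrightarrow> (\<lambda>n. R (u n)) \<longlonglongrightarrow> z \<longrightarrow> R x = z) \<and>
      (\<forall>y\<in>domD. \<forall>x\<in>domR. cinner (R x) y = cinner x (adjoint_op domR R y))"
    using R
  proof (elim disjE conjE)
    assume sym: "symmetric_op domR R" and rel: "relatively_compact_op domD D domR R"
    have sub: "domD \<subseteq> domR" using rel by (simp add: relatively_compact_op_def)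
    have "adjoint_op domR R y = R y" if "y \<in> domD" for y
      using sym sub that by (intro adjoint_op_eqI) (auto simp: symmetric_op_def)
    then have "\<forall>y\<in>domD. \<forall>x\<in>domR. cinner (R x) y = cinner x (adjoint_op domR R y)"
      using sym sub by (simp add: symmetric_op_def subset_iff)
    moreover have "linear_op domR R" using sym by (simp add: symmetric_op_def)
    moreover have "R x = z"
      if "\<forall>n. u n \<in> domR" "u \<longlonglongrightarrow> x" "x \<in> domR" "(\<lambda>n. R (u n)) \<longlonglongrightarrow> z" for u x z
      by (rule symmetric_op_closable[OF sym _ that(2-4)]) (use that(1) in blast)
    ultimately show ?thesis using sub by (intro conjI allI impI)
  next
    assume UNIV: "domR = UNIV" and K: "compact_op R"
    interpret R: bounded_linear R by (rule compact_op_bounded_linear[OF K])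
    have lin: "linear_op UNIV R" using K by (simp add: compact_op_def)
    have "cinner (R x) y = cinner x (adjoint_op UNIV R y)" for x y
    proof -
      obtain z where z: "\<forall>x. cinner (R x) y = cinner x z"
        using bounded_operator_has_adjoint[OF R.bounded_linear_axioms lin] by blast
      then have "adjoint_op UNIV R y = z" by (intro adjoint_op_eqI) simp_all
      then show ?thesis using z by simp
    qed
    moreover have "R x = z" if "u \<longlonglongrightarrow> x" "(\<lambda>n. R (u n)) \<longlonglongrightarrow> z" for u x z
      by (rule LIMSEQ_unique[OF R.tendsto[OF that(1)] that(2)])
    ultimately show ?thesis using lin unfolding UNIV by (intro conjI allI impI ballI subset_UNIV)
  qed
  \<comment> \<open>\<open>k \<ge> 1\<close> means \<open>n \<ge> 2\<close>, so that
    \<open>\<mu> n\<close> has a neighbour on each side.\<close>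
  have level: "isolated_level b domD D \<nu> R k (half_gap \<mu> (Suc k)) (Delta D R \<mu> e (Suc k))"
    if "k \<ge> 1" and small: "Delta D R \<mu> e (Suc k) \<le> 1 / 4" for k
  proof -
    define n where "n = Suc k"
    have n: "n \<ge> 2" using that by (simp add: n_def)
    define \<Delta> where "\<Delta> = Delta D R \<mu> e n"
    have term_eq: "Delta_term D R \<mu> e n m =
        (norm (R (e m)) / (if m = n then half_gap \<mu> n else \<bar>\<mu> m - \<mu> n\<bar> - half_gap \<mu> n))\<^sup>2" if "m \<ge> 1" for m
      using eigen that by (intro Delta_term_eq[OF basis mu_mono _ n]) auto
    have infsum_nonneg: "0 \<le> infsum (Delta_term D R \<mu> e n) {1..}"
      by (rule infsum_nonneg) (simp add: Delta_term_def)
    then have \<Delta>: "\<Delta> \<ge> 0" "\<Delta>\<^sup>2 = infsum (Delta_term D R \<mu> e n) {1..}"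
      by (simp_all add: \<Delta>_def Delta_def)
    show ?thesis
      unfolding n_def[symmetric] \<Delta>_def[symmetric]
    proof unfold_locales
      show "linear_op domD R"
        by (rule linear_op_subset[of domR]) (use R_props S_subspace in simp_all)
      show "R x = z" if "\<And>n. u n \<in> domD" "u \<longlonglongrightarrow> x" "x \<in> domD" "(\<lambda>n. R (u n)) \<longlonglongrightarrow> z" for u x z
      proof -
        have "\<forall>n. u n \<in> domR" "x \<in> domR" using R_props that(1,3) by auto
        then show ?thesis using R_props that(2,4) by simp
      qed
      show "filterlim \<nu> at_top sequentially"
        unfolding \<nu>_def[abs_def] using mu_lim filterlim_sequentially_Suc by blast
      show "half_gap \<mu> n > 0" by (rule half_gap_pos[OF mu_mono n])
      show "2 * half_gap \<mu> n \<le> \<bar>\<nu> m - \<nu> k\<bar>" if "m \<noteq> k" for m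
        using half_gap_le[OF mu_mono n, of "Suc m"] that by (simp add: \<nu>_def n_def)
      show "\<Delta> \<ge> 0" "\<Delta> \<le> 1 / 4" using \<Delta> small by (simp_all add: \<Delta>_def n_def)
      show "(\<Sum>m<N. (norm (R (b m)) / (if m = k then half_gap \<mu> n else \<bar>\<nu> m - \<nu> k\<bar> - half_gap \<mu> n))\<^sup>2)
          \<le> \<Delta>\<^sup>2" for N
      proof -
        have "(\<Sum>m<N. (norm (R (b m)) / (if m = k then half_gap \<mu> n else \<bar>\<nu> m - \<nu> k\<bar> - half_gap \<mu> n))\<^sup>2)
            = sum (Delta_term D R \<mu> e n) (Suc ` {..<N})"
          unfolding sum.reindex[OF inj_Suc[THEN inj_on_subset, OF subset_UNIV]] o_def
          by (intro sum.cong refl, subst term_eq) (auto simp: b_def \<nu>_def n_def)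
        also have "\<dots> \<le> infsum (Delta_term D R \<mu> e n) {1..}"
          using Delta_exists n by (intro finite_sum_le_infsum) (auto simp: Delta_term_def)
        finally show ?thesis by (simp add: \<Delta>)
      qed
    qed
  qed
  have "\<forall>\<^sub>F n in sequentially. Delta D R \<mu> e n < 1 / 4"
    using Delta_lim by (rule order_tendstoD) simp
  with eventually_ge_at_top[of 2]
  have level_ev: "\<forall>\<^sub>F n in sequentially. \<exists>k. n = Suc k \<and>
      isolated_level b domD D \<nu> R k (half_gap \<mu> n) (Delta D R \<mu> e n)"
  proof eventually_elim
    case (elim n)
    then show ?case using level[of "n - 1"] by (intro exI[of _ "n - 1"]) simp
  qed
  show ?thesis
  proof (intro conjI allI impI)
    \<comment> \<open>One index at which the level is isolated yields a point with compact
      resolvent, and with it discreteness.\<close>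
    obtain n k where "isolated_level b domD D \<nu> R k (half_gap \<mu> n) (Delta D R \<mu> e n)"
      using eventually_happens[OF level_ev] by auto
    then show "discrete_spectrum domD (\<lambda>x. D x + R x)"
      by (rule isolated_level.discrete_spectrum_perturbed)
  next
    show "\<forall>\<^sub>F n in sequentially. \<exists>!z. eigenvalue_op domD (\<lambda>x. D x + R x) z \<and>
        cmod (z - complex_of_real (\<mu> n)) < half_gap \<mu> n"
      using level_ev
    proof eventually_elim
      case (elim n)
      then obtain k where n: "n = Suc k"
        and "isolated_level b domD D \<nu> R k (half_gap \<mu> n) (Delta D R \<mu> e n)" by blast
      from isolated_level.ex1_eigenvalue[OF this(2)] show ?case by (simp add: n \<nu>_def)
    qed
  next
    fix ev :: "nat \<Rightarrow> complex"
    assume "\<forall>\<^sub>F n in sequentially. eigenvalue_op domD (\<lambda>x. D x + R x) (ev n) \<and>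
      cmod (ev n - complex_of_real (\<mu> n)) < half_gap \<mu> n"
    with level_ev
    have "\<forall>\<^sub>F n in sequentially. cmod (ev n - (complex_of_real (\<mu> n) + cinner (R (e n)) (e n)))
        \<le> 2 * cmod (complex_of_real (Delta D R \<mu> e n * norm (adjoint_op domR R (e n))))"
    proof eventually_elim
      case (elim n)
      then obtain k where n: "n = Suc k"
        and "isolated_level b domD D \<nu> R k (half_gap \<mu> n) (Delta D R \<mu> e n)" by blast
      then interpret isolated_level b domD D \<nu> R k "half_gap \<mu> n" "Delta D R \<mu> e n" by simp
      \<comment> \<open>The vector \<open>s\<close> of the estimate is the adjoint applied to
        \<open>b k\<close>; the constant 2 is independent of \<open>n\<close> and serves as the
        constant of the Landau symbol.\<close>
      have "cmod (ev n - (complex_of_real (\<nu> k) + cinner (R (b k)) (b k)))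
          \<le> 2 * (Delta D R \<mu> e n * norm (adjoint_op domR R (b k)))"
        using elim(2) R_props b_dom[of k] by (intro eigenvalue_estimate) (auto simp: n \<nu>_def)
      then show ?case using \<Delta>_nonneg by (simp add: n \<nu>_def b_def norm_mult)
    qed
    then show "(\<lambda>n. ev n - (complex_of_real (\<mu> n) + cinner (R (e n)) (e n)))
        \<in> O(\<lambda>n. complex_of_real (Delta D R \<mu> e n * norm (adjoint_op domR R (e n))))"
      by (rule bigoI)
  qed
qed

end
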